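(* Let $\mathcal{D}=\mathbb{C}[\partial_1,\partial_3,\partial_5,\ldots]$ act on $A$, and let $\mathrm{ev}_1:\mathcal{D}\otimes\mathbb{C}[\bar S_2,\bar S_4,\ldots]\to A$ and $\mathrm{ev}_2:\mathcal{D}\otimes\tilde H^\ast_{-1}\to A$ be the $\mathcal{D}$-linear maps defined in the context. Then $\mathrm{ev}_1$ is surjective if and only if $\mathrm{ev}_2$ is surjective.
   Context: The KdV ring. Let $A=\mathbb{C}[u^{(0)},u^{(1)},u^{(2)},\ldots]$ be the polynomial ring in infinitely many variables, $u=u^{(0)}$, with the derivation $'$ given by $(u^{(m)})'=u^{(m+1)}$. Define $S_2,S_4,\ldots\in A$ (elements without constant term) recursively by $S_2=-\frac12 u$ and $S_{n+2}'=\frac14 S_n'''-uS_n'-\frac12 u'S_n$ for $n=2,4,\ldots$. For odd $n\ge1$ let $\partial_n$ be the derivation of $A$ with $\partial_n(u^{(k)})=(S_{n+1})^{(k+1)}$ (the $(k+1)$-fold $'$-derivative); these commute (the KdV hierarchy), $\partial_1={}'$, and $A$ is a module over $\mathcal{D}=\mathbb{C}[\partial_1,\partial_3,\ldots]$. For odd $i,j\ge1$ let $\zeta_{ij}\in A$ be $\partial_i\partial_j\log\tau$ ($\tau$ the KdV tau function) written as a differential polynomial in $u$; equivalently, $\zeta_{ij}$ is the element of $A$ with zero constant term satisfying $\partial_1\zeta_{ij}=\partial_i(S_{j+1})$; in particular $\zeta_{1,2n-1}=S_{2n}$. The map $\mathrm{ev}_1$. Let $\bar S_{2n}$ be polynomials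 in commuting variables $J_2,J_4,\ldots$ defined by $\exp(-\sum_{k\ge1}\frac1k J_{2k}z^{-2k})=\sum_{n\ge0}\bar S_{2n}z^{-2n}$; then $\mathbb{C}[J_2,J_4,\ldots]=\mathbb{C}[\bar S_2,\bar S_4,\ldots]$. Define $\mathrm{ev}_1(P\otimes \bar S_2^{a_2}\bar S_4^{a_4}\cdots)=P(S_2^{a_2}S_4^{a_4}\cdots)$ for $P\in\mathcal{D}$, extended linearly. The map $\mathrm{ev}_2$. Let $\tilde\psi_n,\tilde\psi^\ast_n$ ($n\in2\mathbb{Z}+1$) satisfy $[\tilde\psi_m,\tilde\psi_n]_+=[\tilde\psi^\ast_m,\tilde\psi^\ast_n]_+=0$, $[\tilde\psi^\ast_m,\tilde\psi_n]_+=\delta_{mn}$, where $[X,Y]_+=XY+YX$. For odd $m$ the bra vacuum $\langle m|$ satisfies $\langle m|\tilde\psi_n=0$ for $n\le m$, $\langle m|\tilde\psi^\ast_n=0$ for $n>m$, and $\langle m-2|\tilde\psi_m=\langle m|$. $\tilde H^\ast_m$ is the Fock space of bra vectors obtained from $\langle m|$ by right multiplication with products containing equal numbers of $\tilde\psi$'s and $\tilde\psi^\ast$'s. Put $\alpha_i=\tilde\psi_{-i}$, $\beta_i=\tilde\psi_i$ for odd $i\ge1$. For $N\ge0$, $0\le k\le N$, odd integers $2N+1>i_{N-k}>\cdots>i_1\ge1$ and odd $j_k>\cdots>j_1\ge1$, the vectors $v=\langle -2N-1|\alpha_{i_{N-k}}\cdots\alpha_{i_1}\beta_{j_k}\cdots\beta_{j_1}$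 lie in $\tilde H^\ast_{-1}$ and, over all $N$, span it. Let $I=(i_{N-k},\ldots,i_1)$, $\{l_k>\cdots>l_1\}=\{1,3,\ldots,2N-1\}\setminus I$, and $\mathrm{sgn}(I,I^c)$ the sign of the permutation taking $(2N-1,\ldots,3,1)$ to $(i_{N-k},\ldots,i_1,l_k,\ldots,l_1)$. Then $\mathrm{ev}_2$ is the $\mathcal{D}$-linear map with $\mathrm{ev}_2(P\otimes v)=P\big(\mathrm{sgn}(I,I^c)\det(\zeta_{l_aj_b})_{1\le a,b\le k}\big)$ (determinant $=1$ if $k=0$); this is independent of the choice of $N$ under the identification $\langle-2N-1|a=\langle -2N'-1|\alpha_{2N'-1}\alpha_{2N'-3}\cdots\alpha_{2N+1}a$ for $N<N'$. Equivalently, writing $\mathrm{vol}=\cdots\wedge dt_5\wedge dt_3\wedge dt_1$ and $d\zeta_j=\sum_{m\text{ odd}}\zeta_{jm}dt_m$, $\mathrm{ev}_2(P\otimes v)\,\mathrm{vol}=P(\cdots\wedge dt_{2N+3}\wedge dt_{2N+1}\wedge dt_{i_{N-k}}\wedge\cdots\wedge dt_{i_1}\wedge d\zeta_{j_k}\wedge\cdots\wedge d\zeta_{j_1})$. *)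

theory Defs
  imports Complex_Main "HOL-Library.Poly_Mapping" "HOL-Combinatorics.Permutations"
begin

text \<open>A monomial is a finitely supported exponent vector (index k stands for u^(k));
  a polynomial is a finitely supported map from monomials to complex coefficients.\<close>
type_synonym kdv_ring = "(nat \<Rightarrow>\<^sub>0 nat) \<Rightarrow>\<^sub>0 complex"

definition cst :: "complex \<Rightarrow> kdv_ring" where
  "cst c = Poly_Mapping.single 0 c"

definition uvar :: "nat \<Rightarrow> kdv_ring" where
  "uvar k = Poly_Mapping.single (Poly_Mapping.single k 1) 1"

definition const_term :: "kdv_ring \<Rightarrow> complex" where
  "const_term p = Poly_Mapping.lookup p 0"

text \<open>The unique C-linear derivation of A sending u^(k) to f k.\<close>
definition derivation_ext :: "(nat \<Rightarrow> kdv_ring) \<Rightarrow> kdv_ring \<Rightarrow> kdv_ring" where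
  "derivation_ext f p =
     (\<Sum>m\<in>Poly_Mapping.keys p. \<Sum>k\<in>Poly_Mapping.keys m.
        cst (Poly_Mapping.lookup p m * of_nat (Poly_Mapping.lookup m k))
        * Poly_Mapping.single (m - Poly_Mapping.single k 1) 1 * f k)"

definition dprime :: "kdv_ring \<Rightarrow> kdv_ring" where
  "dprime = derivation_ext (\<lambda>k. uvar (Suc k))"

definition antider :: "kdv_ring \<Rightarrow> kdv_ring" where
  "antider q = (THE p. dprime p = q \<and> const_term p = 0)"

text \<open>KdV_S m = S_{2m} for m \<ge> 1 (KdV_S 0 is an unused dummy value).\<close>
primrec KdV_S :: "nat \<Rightarrow> kdv_ring" where
  "KdV_S 0 = 0"
| "KdV_S (Suc m) =
     (if m = 0 then cst (-1/2) * uvar 0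
      else antider (cst (1/4) * (dprime ^^ 3) (KdV_S m)
                    - uvar 0 * dprime (KdV_S m)
                    - cst (1/2) * uvar 1 * KdV_S m))"

text \<open>S n for even n \<ge> 2 is S_n.\<close>
definition S :: "nat \<Rightarrow> kdv_ring" where
  "S n = KdV_S (n div 2)"

text \<open>KdV flow \<partial>_n for odd n: the derivation with u^(k) \<mapsto> (S_{n+1})^(k+1).\<close>
definition kdv_flow :: "nat \<Rightarrow> kdv_ring \<Rightarrow> kdv_ring" where
  "kdv_flow n = derivation_ext (\<lambda>k. (dprime ^^ (Suc k)) (S (n + 1)))"

text \<open>zeta i j (i, j odd): the element with zero constant term such that
  \<partial>_1 zeta = \<partial>_i (S_{j+1}).\<close>
definition zeta :: "nat \<Rightarrow> nat \<Rightarrow> kdv_ring" where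
  "zeta i j = (THE p. kdv_flow 1 p = kdv_flow i (S (j + 1)) \<and> const_term p = 0)"

text \<open>D is the polynomial ring in the formal variables \<partial>_{2i+1}, i \<in> nat;
  a monomial of D is an exponent vector d (d i = exponent of \<partial>_{2i+1}).\<close>
definition D_monomial_act :: "(nat \<Rightarrow>\<^sub>0 nat) \<Rightarrow> kdv_ring \<Rightarrow> kdv_ring" where
  "D_monomial_act d =
     foldr (\<lambda>i g. (kdv_flow (2 * i + 1) ^^ Poly_Mapping.lookup d i) \<circ> g)
           (sorted_list_of_set (Poly_Mapping.keys d)) id"

definition D_act :: "((nat \<Rightarrow>\<^sub>0 nat) \<Rightarrow>\<^sub>0 complex) \<Rightarrow> kdv_ring \<Rightarrow> kdv_ring" where
  "D_act P a = (\<Sum>d\<in>Poly_Mapping.keys P. cst (Poly_Mapping.lookup P d) * D_monomial_act d a)"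

text \<open>A basis of D \<otimes> C[Sbar_2, Sbar_4, ...] is given by pairs (d, s) of a monomial d of D
  and a monomial s of C[Sbar_2, ...] (s i = exponent of Sbar_{2(i+1)}); an element of the
  tensor product is a finitely supported coefficient function on these pairs.\<close>
definition S_monomial :: "(nat \<Rightarrow>\<^sub>0 nat) \<Rightarrow> kdv_ring" where
  "S_monomial s = (\<Prod>i\<in>Poly_Mapping.keys s. S (2 * (i + 1)) ^ Poly_Mapping.lookup s i)"

definition ev1 :: "(((nat \<Rightarrow>\<^sub>0 nat) \<times> (nat \<Rightarrow>\<^sub>0 nat)) \<Rightarrow>\<^sub>0 complex) \<Rightarrow> kdv_ring" where
  "ev1 T = (\<Sum>(d, s)\<in>Poly_Mapping.keys T.
              cst (Poly_Mapping.lookup T (d, s)) * D_monomial_act d (S_monomial s))"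

definition ev1_surjective :: bool where
  "ev1_surjective \<longleftrightarrow> surj ev1"

text \<open>The vectors v of the context are determined (independently of N) by the pair (L, J),
  where L = {l_1 < ... < l_k} is the complement of I in {1,3,...,2N-1} and J = {j_1 < ... < j_k};
  they form a basis of the Fock space H*_{-1}. Valid basis labels:\<close>
definition fock_label :: "nat set \<Rightarrow> nat set \<Rightarrow> bool" where
  "fock_label L J \<longleftrightarrow> finite L \<and> finite J \<and> (\<forall>l\<in>L. odd l) \<and> (\<forall>j\<in>J. odd j)
                       \<and> card L = card J"

text \<open>sgn(I, I^c): the sign of the permutation taking (2N-1,...,3,1) to
  (i_{N-k},...,i_1,l_k,...,l_1), i.e. (-1)^(number of inversions), the inversions being the
  pairs i \<in> I, l \<in> L with i < l.\<close>
definition sgn_IIc :: "nat set \<Rightarrow> int" where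
  "sgn_IIc L = (-1) ^ card {(i, l). l \<in> L \<and> odd i \<and> i \<notin> L \<and> i < l}"

definition detA :: "nat \<Rightarrow> (nat \<Rightarrow> nat \<Rightarrow> kdv_ring) \<Rightarrow> kdv_ring" where
  "detA k M = (\<Sum>p\<in>{p. p permutes {..<k}}. of_int (sign p) * (\<Prod>a<k. M a (p a)))"

definition ev2_basis_value :: "nat set \<Rightarrow> nat set \<Rightarrow> kdv_ring" where
  "ev2_basis_value L J =
     of_int (sgn_IIc L) *
     detA (card L) (\<lambda>a b. zeta (sorted_list_of_set L ! a) (sorted_list_of_set J ! b))"

definition ev2 :: "(((nat \<Rightarrow>\<^sub>0 nat) \<times> (nat set \<times> nat set)) \<Rightarrow>\<^sub>0 complex) \<Rightarrow> kdv_ring" where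
  "ev2 T = (\<Sum>(d, L, J)\<in>Poly_Mapping.keys T.
              cst (Poly_Mapping.lookup T (d, L, J)) * D_monomial_act d (ev2_basis_value L J))"

text \<open>Elements of D \<otimes> H*_{-1}: coefficient functions supported on valid labels.\<close>
definition ev2_surjective :: bool where
  "ev2_surjective \<longleftrightarrow>
     (\<forall>a. \<exists>T. (\<forall>(d, L, J)\<in>Poly_Mapping.keys T. fock_label L J) \<and> ev2 T = a)"

end

theory Submission
  imports Defs "HOL-Computational_Algebra.Formal_Power_Series"
begin

text \<open>
  Let \<open>Q\<close> be the span of the images of the flows. The flows raise the weight (\<open>u\<^sup>(\<^sup>k\<^sup>)\<close> has weight \<open>k + 2\<close>), so a
  graded subspace generates \<open>A\<close> over \<open>\<D>\<close> iff it spans \<open>A\<close> modulo \<open>Q\<close>. Hence it suffices to show that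
  the algebra generated by the \<open>S\<^sub>2\<^sub>n\<close> and the span of the minors of \<open>(\<zeta>\<^sub>i\<^sub>j)\<close> agree modulo \<open>Q\<close>.

  Let \<open>V(q) = \<Sum> S\<^sub>2\<^sub>n q\<^sup>n\<close> with \<open>S\<^sub>0 = 1\<close> and let \<open>G(n, k)\<close> be the coefficient of \<open>p\<^sup>k q\<^sup>n\<close> in
  \<open>p q (V(p) / V(q) - 1) / (p - q)\<close>. The one-forms \<open>\<Sum>\<^sub>k G(n, k) dt\<^sub>2\<^sub>k\<^sub>-\<^sub>1\<close> are closed, and
  \<open>d\<zeta>\<^sub>2\<^sub>n\<^sub>-\<^sub>1 = (2 n - 1) \<Sum>\<^sub>k G(n, k) dt\<^sub>2\<^sub>k\<^sub>-\<^sub>1 + dr\<^sub>n\<close> with \<open>r\<^sub>n \<in> A\<close>. Since replacing a factor of a wedge product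
  of closed forms by an exact form gives an exact form, every minor of \<open>(\<zeta>\<^sub>i\<^sub>j)\<close> is modulo \<open>Q\<close> a nonzero
  multiple of the corresponding minor of \<open>G\<close>. Finally \<open>G(n, k)\<close> is up to sign a hook Schur function of the
  variables whose complete symmetric functions are the \<open>S\<^sub>2\<^sub>n\<close>, so by Giambelli the minors of \<open>G\<close> are
  up to sign the Schur functions, which span \<open>\<complex>[S\<^sub>2, S\<^sub>4, \<dots>]\<close>; here this is shown by multiplying
  minors with power sums.
\<close>

abbreviation lookup where "lookup \<equiv> Poly_Mapping.lookup"
abbreviation keys where "keys \<equiv> Poly_Mapping.keys"
abbreviation single where "single \<equiv> Poly_Mapping.single"

section \<open>Derivations\<close>

locale derivation =
  fixes D :: "'a::comm_ring_1 \<Rightarrow> 'a"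
  assumes add: "D (x + y) = D x + D y"
    and mult: "D (x * y) = D x * y + x * D y"
begin

lemma zero [simp]: "D 0 = 0"
  using add[of 0 0] by simp

lemma one [simp]: "D 1 = 0"
  using mult[of 1 1] by simp

lemma minus: "D (- x) = - D x"
  using add[of x "- x"] by (simp add: eq_neg_iff_add_eq_0 add.commute)

lemma diff: "D (x - y) = D x - D y"
  using add[of x "- y"] minus[of y] by simp

lemma sum: "D (\<Sum>i\<in>I. f i) = (\<Sum>i\<in>I. D (f i))"
  by (induction I rule: infinite_finite_induct) (simp_all add: add)

lemma of_nat [simp]: "D (of_nat n) = 0"
  by (induction n) (simp_all add: add)

lemma numeral [simp]: "D (numeral n) = 0"
  using of_nat[of "numeral n"] by simp

lemma prod:
  assumes "finite I"
  shows "D (\<Prod>i\<in>I. f i) = (\<Sum>i\<in>I. D (f i) * (\<Prod>j\<in>I - {i}. f j))"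
  using assms
proof (induction I)
  case (insert a I)
  have *: "(\<Prod>j\<in>insert a I - {i}. f j) = f a * (\<Prod>j\<in>I - {i}. f j)" if "i \<in> I" for i
  proof -
    have "insert a I - {i} = insert a (I - {i})"
      using insert.hyps that by auto
    then show ?thesis
      using insert.hyps by simp
  qed
  have "insert a I - {a} = I"
    using insert.hyps by auto
  then have "(\<Sum>i\<in>insert a I. D (f i) * (\<Prod>j\<in>insert a I - {i}. f j)) =
      D (f a) * (\<Prod>j\<in>I. f j) + (\<Sum>i\<in>I. D (f i) * (f a * (\<Prod>j\<in>I - {i}. f j)))"
    using insert.hyps * by (simp cong: sum.cong)
  also have "(\<Sum>i\<in>I. D (f i) * (f a * (\<Prod>j\<in>I - {i}. f j))) = f a * D (\<Prod>j\<in>I. f j)"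
    by (simp add: insert.IH sum_distrib_left mult_ac)
  finally show ?case
    using insert.hyps by (simp add: mult)
qed simp

end

section \<open>Coefficientwise action of a derivation on power series\<close>

definition fps_lift :: "('a \<Rightarrow> 'a::comm_ring_1) \<Rightarrow> 'a fps \<Rightarrow> 'a fps" where
  "fps_lift D F = Abs_fps (\<lambda>n. D (fps_nth F n))"

lemma fps_lift_nth [simp]: "fps_nth (fps_lift D F) n = D (fps_nth F n)"
  by (simp add: fps_lift_def)

lemma derivation_fps_lift:
  assumes "derivation D"
  shows "derivation (fps_lift D)"
proof
  interpret derivation D by fact
  fix F G
  show "fps_lift D (F + G) = fps_lift D F + fps_lift D G"
    by (simp add: fps_eq_iff add)
  show "fps_lift D (F * G) = fps_lift D F * G + F * fps_lift D G"
    by (simp add: fps_eq_iff fps_mult_nth sum mult sum.distrib)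
qed

lemma fps_lift_deriv:
  assumes "derivation D"
  shows "fps_lift D (fps_deriv F) = fps_deriv (fps_lift D F)"
proof -
  interpret derivation D by fact
  show ?thesis
    by (simp add: fps_eq_iff mult algebra_simps add)
qed

lemma fps_lift_const:
  assumes "derivation D"
  shows "fps_lift D (fps_const a) = fps_const (D a)"
proof -
  interpret derivation D by fact
  show ?thesis
    by (simp add: fps_eq_iff)
qed

lemma fps_lift_X:
  assumes "derivation D"
  shows "fps_lift D fps_X = 0"
proof -
  interpret derivation D by fact
  show ?thesis
    by (simp add: fps_eq_iff fps_X_def)
qed

section \<open>The differential polynomial ring\<close>

lemma cst_0 [simp]: "cst 0 = 0" and cst_1 [simp]: "cst 1 = 1"
  by (simp_all add: cst_def)

lemma cst_add: "cst (a + b) = cst a + cst b"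
  by (simp add: cst_def single_add)

lemma cst_mult: "cst (a * b) = cst a * cst b"
  by (simp add: cst_def mult_single)

lemma cst_minus: "cst (- a) = - cst a"
  by (simp add: cst_def single_uminus)

lemma cst_of_nat: "cst (of_nat n) = of_nat n"
  by (induction n) (simp_all add: cst_add)

lemma cst_numeral: "cst (numeral n) = numeral n"
  using cst_of_nat[of "numeral n"] by simp

lemma cst_of_int: "cst (of_int n) = of_int n"
  by (cases n rule: int_cases2) (simp_all add: cst_of_nat cst_minus)

lemma lookup_cst_mult [simp]: "lookup (cst c * p) m = c * lookup p m"
proof -
  have "cst c * p = Poly_Mapping.map ((*) c) p"
    by (metis cst_def mult_map_scale_conv_mult)
  then show ?thesis
    by (simp add: Poly_Mapping.map.rep_eq when_def)
qed

lemma single_eq: "single m c = cst c * single m 1"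
  by (simp add: cst_def mult_single)

interpretation kdv: vector_space "\<lambda>c p. cst c * p"
  by standard (simp_all add: algebra_simps cst_add cst_mult)

(* scale_scale loops with cst_mult *)
declare kdv.scale_scale [simp del] kdv.scale_minus_left [simp del] kdv.scale_minus_right [simp del]

lemma poly_mapping_sum_monomials: "(\<Sum>k\<in>keys p. single k (lookup p k)) = p"
  by (intro poly_mapping_eqI) (auto simp: lookup_sum lookup_single when_def in_keys_iff)

lemma kdv_sum_single: "p = (\<Sum>m\<in>keys p. cst (lookup p m) * single m 1)"
  by (subst poly_mapping_sum_monomials[of p, symmetric]) (simp add: single_eq[symmetric])

text \<open>Common form of \<open>derivation_ext f\<close>, \<open>ev1\<close> and
  \<open>ev2\<close>: each is the linear map with prescribed values on a basis.\<close>

definition lin_ext :: "('i \<Rightarrow> kdv_ring) \<Rightarrow> ('i \<Rightarrow>\<^sub>0 complex) \<Rightarrow> kdv_ring" where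
  "lin_ext h T = (\<Sum>x\<in>keys T. cst (lookup T x) * h x)"

lemma lin_ext_superset:
  assumes "finite I" "keys T \<subseteq> I"
  shows "lin_ext h T = (\<Sum>x\<in>I. cst (lookup T x) * h x)"
  unfolding lin_ext_def using assms
  by (intro sum.mono_neutral_left) (auto simp: in_keys_iff)

lemma lin_ext_add: "lin_ext h (T + U) = lin_ext h T + lin_ext h U"
proof -
  let ?I = "keys T \<union> keys U"
  have "lin_ext h (T + U) = (\<Sum>x\<in>?I. cst (lookup (T + U) x) * h x)"
    by (rule lin_ext_superset) (auto simp: Poly_Mapping.keys_add)
  also have "\<dots> = (\<Sum>x\<in>?I. cst (lookup T x) * h x) + (\<Sum>x\<in>?I. cst (lookup U x) * h x)"
    by (simp add: lookup_add cst_add algebra_simps sum.distrib)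
  also have "\<dots> = lin_ext h T + lin_ext h U"
    by (simp add: lin_ext_superset[of ?I])
  finally show ?thesis .
qed

lemma lin_ext_single: "lin_ext h (single x c) = cst c * h x"
  by (cases "c = 0") (simp_all add: lin_ext_def)

text \<open>Turns the surjectivity of \<open>ev1\<close> and \<open>ev2\<close> into statements
  about spans.\<close>

lemma lin_ext_image_eq_span:
  "{lin_ext h T |T. keys T \<subseteq> I} = kdv.span (h ` I)"
proof (intro subset_antisym subsetI)
  fix a assume "a \<in> {lin_ext h T |T. keys T \<subseteq> I}"
  then show "a \<in> kdv.span (h ` I)"
    unfolding lin_ext_def
    by (auto intro!: kdv.span_sum kdv.span_scale intro: kdv.span_base)
next
  fix a assume "a \<in> kdv.span (h ` I)"
  then show "a \<in> {lin_ext h T |T. keys T \<subseteq> I}"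
  proof (induction rule: kdv.span_induct_alt)
    case base
    show ?case
      by (auto simp: lin_ext_def intro!: exI[of _ 0])
  next
    case (step c x y)
    then obtain T i where T: "y = lin_ext h T" "keys T \<subseteq> I" "x = h i" "i \<in> I"
      by auto
    then have "cst c * x + y = lin_ext h (single i c + T)"
      by (simp add: lin_ext_add lin_ext_single)
    moreover have "keys (single i c + T) \<subseteq> I"
      using T Poly_Mapping.keys_add[of "single i c" T] by (auto split: if_splits)
    ultimately show ?case
      by blast
  qed
qed

lemma single_eq_prod: "single m (1::complex) = (\<Prod>k\<in>keys m. uvar k ^ lookup m k)"
proof -
  have pow: "uvar k ^ n = single (single k n) 1" for k n
    by (induction n) (simp_all add: uvar_def mult_single single_add[symmetric])
  have "(\<Prod>k\<in>I. single (single k (f k)) (1::complex)) = single (\<Sum>k\<in>I. single k (f k)) 1"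
    if "finite I" for f :: "nat \<Rightarrow> nat" and I
    using that by (induction I) (simp_all add: mult_single)
  then show ?thesis
    by (simp add: pow poly_mapping_sum_monomials)
qed

lemma kdv_ring_induct [case_names cst uvar add mult]:
  assumes "\<And>c. P (cst c)" "\<And>k. P (uvar k)"
    and "\<And>p q. P p \<Longrightarrow> P q \<Longrightarrow> P (p + q)" "\<And>p q. P p \<Longrightarrow> P q \<Longrightarrow> P (p * q)"
  shows "P p"
proof -
  have one: "P 1"
    using assms(1)[of 1] by simp
  have pow: "P (q ^ n)" if "P q" for q n
    by (induction n) (simp_all add: one assms(4) that)
  have prod: "P (\<Prod>k\<in>I. uvar k ^ f k)" if "finite I" for f :: "nat \<Rightarrow> nat" and I
    using that by (induction I) (simp_all add: one assms pow)
  have "P (\<Sum>m\<in>I. cst (f m) * single m 1)" if "finite I" for f I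
    using that
  proof (induction I)
    case empty
    show ?case using assms(1)[of 0] by simp
  next
    case (insert m I)
    then show ?case
      using assms(1)[of "f m"] prod[of "keys m" "lookup m"]
      by (simp add: assms(3,4) single_eq_prod[symmetric])
  qed
  then show ?thesis
    by (subst kdv_sum_single) simp
qed

section \<open>Derivations prescribed on the generators\<close>

lemma derivation_ext_eq_lin_ext:
  "derivation_ext f = lin_ext (\<lambda>m. \<Sum>k\<in>keys m.
     of_nat (lookup m k) * single (m - single k 1) 1 * f k)"
  by (simp add: fun_eq_iff derivation_ext_def lin_ext_def sum_distrib_left cst_mult cst_of_nat mult_ac)

lemma derivation_ext_single:
  assumes "finite I" "keys m \<subseteq> I"
  shows "derivation_ext f (single m 1) =
    (\<Sum>k\<in>I. of_nat (lookup m k) * single (m - single k 1) 1 * f k)"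
  unfolding derivation_ext_eq_lin_ext lin_ext_single cst_1 mult_1 using assms
  by (intro sum.mono_neutral_left) (auto simp: in_keys_iff)

lemma derivation_ext_single_mult:
  "derivation_ext f (single m 1 * single n 1) =
    derivation_ext f (single m 1) * single n 1 + single m 1 * derivation_ext f (single n 1)"
proof -
  let ?I = "keys m \<union> keys n"
  \<comment> \<open>Subtraction of exponents is truncated: moving it into \<open>m\<close> needs
    \<open>k\<close> to occur in \<open>m\<close>, moving it into \<open>n\<close> needs
    \<open>k\<close> to occur in \<open>n\<close>. A term whose condition fails has coefficient
    zero.\<close>
  have *: "of_nat (lookup (m + n) k) * single (m + n - single k 1) (1::complex) =
    of_nat (lookup m k) * single (m - single k 1) 1 * single n 1 +
    single m 1 * (of_nat (lookup n k) * single (n - single k 1) 1)" for k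
  proof -
    have "m + n - single k 1 = m - single k 1 + n" if "lookup m k \<noteq> 0"
      using that by (intro poly_mapping_eqI) (auto simp: lookup_add lookup_minus lookup_single when_def)
    moreover have "m + n - single k 1 = m + (n - single k 1)" if "lookup n k \<noteq> 0"
      using that by (intro poly_mapping_eqI) (auto simp: lookup_add lookup_minus lookup_single when_def)
    ultimately show ?thesis
      by (cases "lookup m k = 0"; cases "lookup n k = 0")
         (simp_all add: lookup_add mult_single mult.assoc distrib_right mult.left_commute[of "single m 1"])
  qed
  have "derivation_ext f (single m 1 * single n 1) = (\<Sum>k\<in>?I.
      of_nat (lookup (m + n) k) * single (m + n - single k 1) 1 * f k)"
    using Poly_Mapping.keys_add[of m n]
    by (simp add: mult_single derivation_ext_single[of ?I])
  also have "\<dots> = (\<Sum>k\<in>?I. of_nat (lookup m k) * single (m - single k 1) 1 * f k) * single n 1 +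
      single m 1 * (\<Sum>k\<in>?I. of_nat (lookup n k) * single (n - single k 1) 1 * f k)"
    unfolding * by (simp add: sum_distrib_left sum_distrib_right sum.distrib algebra_simps)
  finally show ?thesis
    by (simp add: derivation_ext_single[of ?I])
qed

lemma derivation_ext_add: "derivation_ext f (p + q) = derivation_ext f p + derivation_ext f q"
  by (simp add: derivation_ext_eq_lin_ext lin_ext_add)

lemma derivation_ext_0 [simp]: "derivation_ext f 0 = 0"
  by (simp add: derivation_ext_def)

lemma derivation_ext_sum: "derivation_ext f (\<Sum>i\<in>I. g i) = (\<Sum>i\<in>I. derivation_ext f (g i))"
  by (induction I rule: infinite_finite_induct) (simp_all add: derivation_ext_add)

lemma derivation_ext_scale: "derivation_ext f (cst c * p) = cst c * derivation_ext f p"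
proof -
  have *: "derivation_ext f (cst c * (cst d * single m 1)) =
      cst c * derivation_ext f (cst d * single m 1)" for m d
  proof -
    have "cst c * (cst d * single m 1) = single m (c * d)" "cst d * single m 1 = single m d"
      by (simp_all add: cst_def mult_single)
    then show ?thesis
      by (simp only: derivation_ext_eq_lin_ext lin_ext_single cst_mult mult.assoc)
  qed
  have "derivation_ext f (cst c * (\<Sum>m\<in>keys p. cst (lookup p m) * single m 1)) =
      cst c * derivation_ext f (\<Sum>m\<in>keys p. cst (lookup p m) * single m 1)"
    by (simp only: sum_distrib_left derivation_ext_sum *)
  then show ?thesis
    by (simp only: kdv_sum_single[of p, symmetric])
qed

lemma derivation_derivation_ext: "derivation (derivation_ext f)"
proof
  fix p q :: kdv_ring
  show "derivation_ext f (p + q) = derivation_ext f p + derivation_ext f q"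
    by (rule derivation_ext_add)
  have *: "derivation_ext f (cst c * single m 1 * (cst d * single n 1)) =
    derivation_ext f (cst c * single m 1) * (cst d * single n 1) +
    cst c * single m 1 * derivation_ext f (cst d * single n 1)" for c d m n
  proof -
    have "cst c * single m 1 * (cst d * single n 1) = cst (c * d) * (single m 1 * single n 1)"
      by (simp add: cst_mult mult_ac)
    then show ?thesis
      by (simp only: derivation_ext_scale derivation_ext_single_mult)
         (simp add: cst_mult algebra_simps)
  qed
  \<comment> \<open>The product rule is extended from monomials in two rounds: first
    \<open>q\<close> is expanded against a fixed term, then \<open>p\<close> is.\<close>
  have **: "derivation_ext f (cst c * single m 1 * q) =
    derivation_ext f (cst c * single m 1) * q + cst c * single m 1 * derivation_ext f q" for c m
  proof -
    have "derivation_ext f (cst c * single m 1 * r) =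
      derivation_ext f (cst c * single m 1) * r + cst c * single m 1 * derivation_ext f r"
      if "r = (\<Sum>m\<in>keys q. cst (lookup q m) * single m 1)" for r
      unfolding that by (simp only: sum_distrib_left derivation_ext_sum * sum.distrib)
    from this[OF kdv_sum_single] show ?thesis .
  qed
  have "derivation_ext f (r * q) = derivation_ext f r * q + r * derivation_ext f q"
    if "r = (\<Sum>m\<in>keys p. cst (lookup p m) * single m 1)" for r
    unfolding that by (simp only: sum_distrib_right derivation_ext_sum ** sum.distrib)
  from this[OF kdv_sum_single]
  show "derivation_ext f (p * q) = derivation_ext f p * q + p * derivation_ext f q" .
qed

lemma derivation_ext_uvar [simp]: "derivation_ext f (uvar k) = f k"
  using derivation_ext_single[of "{k}" "single k 1" f] by (simp add: uvar_def)

lemma derivation_ext_cst [simp]: "derivation_ext f (cst c) = 0"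
proof -
  have "derivation_ext f (cst c * 1) = cst c * derivation_ext f 1"
    by (rule derivation_ext_scale)
  then show ?thesis
    by (simp add: derivation.one[OF derivation_derivation_ext])
qed

lemma derivation_eqI:
  assumes "derivation D" "derivation E" "\<And>c. D (cst c) = E (cst c)" "\<And>k. D (uvar k) = E (uvar k)"
  shows "D p = E p"
proof -
  interpret D: derivation D by fact
  interpret E: derivation E by fact
  show ?thesis
    by (induction p rule: kdv_ring_induct) (simp_all add: assms D.add E.add D.mult E.mult)
qed

lemma derivation_commutator:
  assumes "derivation D" "derivation E"
  shows "derivation (\<lambda>p. D (E p) - E (D p))"
proof -
  interpret D: derivation D by fact
  interpret E: derivation E by fact
  show ?thesis
    by standard (simp_all add: D.add E.add D.mult E.mult algebra_simps)
qed

text \<open>The commutator of two derivations is again a derivation, and by hypothesis this one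
  kills all generators.\<close>

lemma derivation_ext_commute:
  assumes "\<And>k. derivation_ext f (g k) = derivation_ext g (f k)"
  shows "derivation_ext f (derivation_ext g p) = derivation_ext g (derivation_ext f p)"
proof -
  have "derivation_ext f (derivation_ext g p) - derivation_ext g (derivation_ext f p) =
      derivation_ext (\<lambda>_. 0) p"
    by (rule derivation_eqI[OF derivation_commutator])
       (simp_all add: derivation_derivation_ext assms)
  also have "\<dots> = 0"
    by (simp add: derivation_ext_def)
  finally show ?thesis by simp
qed

interpretation dp: derivation dprime
  unfolding dprime_def by (rule derivation_derivation_ext)

lemma dprime_uvar [simp]: "dprime (uvar k) = uvar (Suc k)"
  and dprime_cst [simp]: "dprime (cst c) = 0"
  and dprime_scale: "dprime (cst c * p) = cst c * dprime p"
  by (simp_all add: dprime_def derivation_ext_scale)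

section \<open>The kernel of the total derivative\<close>

text \<open>The chain rule: \<open>derivation_ext (\<lambda>j. if j = k then 1 else 0)\<close> is
  the partial derivative with respect to \<open>uvar k\<close>.\<close>

lemma derivation_ext_eq_sum_partials:
  assumes "finite K" "\<And>m. m \<in> keys p \<Longrightarrow> keys m \<subseteq> K"
  shows "derivation_ext f p = (\<Sum>k\<in>K. f k * derivation_ext (\<lambda>j. if j = k then 1 else 0) p)"
proof -
  have "derivation_ext f (single m 1) =
      (\<Sum>k\<in>K. f k * derivation_ext (\<lambda>j. if j = k then 1 else 0) (single m 1))" if "m \<in> keys p" for m
    using assms(1) assms(2)[OF that]
    by (simp add: derivation_ext_single[of K] mult_ac if_distrib[of "\<lambda>x. x * _"]
          if_distrib[of "\<lambda>x. _ * x"] sum.delta cong: if_cong)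
  then have "derivation_ext f p = (\<Sum>m\<in>keys p. \<Sum>k\<in>K. cst (lookup p m) *
      (f k * derivation_ext (\<lambda>j. if j = k then 1 else 0) (single m 1)))"
    by (subst kdv_sum_single[of p])
       (simp add: derivation_ext_sum derivation_ext_scale sum_distrib_left)
  also have "\<dots> = (\<Sum>k\<in>K. f k * derivation_ext (\<lambda>j. if j = k then 1 else 0)
      (\<Sum>m\<in>keys p. cst (lookup p m) * single m 1))"
    by (subst sum.swap)
       (simp add: derivation_ext_sum derivation_ext_scale sum_distrib_left mult.left_commute)
  finally show ?thesis
    by (simp only: kdv_sum_single[of p, symmetric])
qed

text \<open>The commutator of the partial derivative number k + 1 with \<open>dprime\<close> is the
  partial derivative number k. Since \<open>p\<close> involves finitely many variables, its high
  partial derivatives vanish, and the commutator carries this down to all of them.\<close>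

lemma dprime_eq_0_imp_const:
  assumes "dprime p = 0"
  shows "p = cst (const_term p)"
proof -
  let ?pd = "\<lambda>k. derivation_ext (\<lambda>j. if j = k then 1 else 0)"
  interpret pd: derivation "?pd k" for k
    by (rule derivation_derivation_ext)
  define K where "K = (\<Union>m\<in>keys p. keys m)"
  have "finite K"
    by (simp add: K_def)
  \<comment> \<open>Both sides are derivations that send \<open>uvar k\<close> to 1 and every other
    generator to 0.\<close>
  have comm: "?pd (Suc k) (dprime p) - dprime (?pd (Suc k) p) = ?pd k p" for k
    by (rule derivation_eqI[OF derivation_commutator])
       (auto simp: derivation_derivation_ext dp.derivation_axioms)
  have big: "?pd k p = 0" if "k \<notin> K" for k
    using that by (subst derivation_ext_eq_sum_partials[of K])
      (auto simp: K_def intro!: sum.neutral)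
  have step: "?pd k p = 0" if "?pd (Suc k) p = 0" for k
    using comm[of k] that assms by simp
  have part: "?pd k p = 0" for k
  proof -
    obtain N where N: "\<forall>k\<in>K. k \<le> N"
      using \<open>finite K\<close> finite_nat_set_iff_bounded_le by blast
    have "?pd (k + (Suc N)) p = 0"
      using big N by (metis le_add2 not_less_eq_eq trans_le_add2)
    moreover have "?pd (k + n) p = 0 \<Longrightarrow> ?pd k p = 0" for n
      by (induction n) (use step in auto)
    ultimately show ?thesis by blast
  qed
  \<comment> \<open>\<open>derivation_ext uvar\<close> is the Euler operator. It multiplies a
    monomial by its total degree, so its kernel consists of the constants.\<close>
  have "derivation_ext uvar p = 0"
    by (subst derivation_ext_eq_sum_partials[of K]) (auto simp: K_def part)
  moreover have "derivation_ext uvar (single m 1) = of_nat (\<Sum>k\<in>keys m. lookup m k) * single m 1" for m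
  proof -
    have "single (m - single k 1) 1 * uvar k = single m 1" if "k \<in> keys m" for k
    proof -
      have "m - single k 1 + single k 1 = m"
        using that by (intro poly_mapping_eqI)
          (auto simp: lookup_add lookup_minus lookup_single when_def in_keys_iff)
      then show ?thesis
        by (simp add: uvar_def mult_single)
    qed
    then show ?thesis
      by (simp add: derivation_ext_single[of "keys m"] mult.assoc sum_distrib_right cong: sum.cong)
  qed
  then have "derivation_ext uvar (\<Sum>m\<in>keys p. cst (lookup p m) * single m 1) =
      (\<Sum>m\<in>keys p. cst (lookup p m * of_nat (\<Sum>k\<in>keys m. lookup m k)) * single m 1)"
    by (simp only: derivation_ext_sum derivation_ext_scale cst_mult cst_of_nat mult.assoc)
  ultimately have *: "(\<Sum>m\<in>keys p. cst (lookup p m * of_nat (\<Sum>k\<in>keys m. lookup m k)) * single m 1) = 0"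
    by (simp only: kdv_sum_single[of p, symmetric])
  have "lookup p m = 0" if "m \<noteq> 0" for m
  proof (rule ccontr)
    assume "lookup p m \<noteq> 0"
    then have "m \<in> keys p" by (simp add: in_keys_iff)
    have "0 = lookup (\<Sum>n\<in>keys p. cst (lookup p n * of_nat (\<Sum>k\<in>keys n. lookup n k)) * single n 1) m"
      unfolding * by simp
    also have "\<dots> = (\<Sum>n\<in>keys p. (lookup p n * of_nat (\<Sum>k\<in>keys n. lookup n k)) when n = m)"
      by (simp add: lookup_sum lookup_single when_def if_distrib[of "\<lambda>x. _ * x"] cong: if_cong)
    also have "\<dots> = lookup p m * of_nat (\<Sum>k\<in>keys m. lookup m k)"
      using \<open>m \<in> keys p\<close> by (simp add: when_def)
    finally have "(\<Sum>k\<in>keys m. lookup m k) = 0"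
      using \<open>lookup p m \<noteq> 0\<close> by (simp add: of_nat_sum[symmetric] del: of_nat_sum)
    then show False
      using that by (auto simp: in_keys_iff poly_mapping_eq_iff fun_eq_iff)
  qed
  then show ?thesis
    by (intro poly_mapping_eqI) (auto simp: cst_def const_term_def lookup_single when_def)
qed

lemma dprime_inj:
  assumes "dprime p = dprime q" "const_term p = const_term q"
  shows "p = q"
proof -
  have "const_term (p - q) = 0"
    using assms by (simp add: const_term_def lookup_minus)
  then show ?thesis
    using dprime_eq_0_imp_const[of "p - q"] assms by (simp add: dp.diff)
qed

lemma const_term_add: "const_term (p + q) = const_term p + const_term q"
  and const_term_diff: "const_term (p - q) = const_term p - const_term q"
  and const_term_scale: "const_term (cst c * p) = c * const_term p"
  and const_term_0 [simp]: "const_term 0 = 0"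
  and const_term_1 [simp]: "const_term 1 = 1"
  and const_term_cst [simp]: "const_term (cst c) = c"
  and const_term_uvar [simp]: "const_term (uvar k) = 0"
  and const_term_sum: "const_term (\<Sum>i\<in>I. g i) = (\<Sum>i\<in>I. const_term (g i))"
  by (simp_all add: const_term_def lookup_add lookup_minus lookup_sum lookup_single lookup_one uvar_def when_def)
     (simp_all add: cst_def lookup_single, metis lookup_single_eq lookup_zero nat.distinct(1))

lemma const_term_mult: "const_term (p * q) = const_term p * const_term q"
proof -
  have *: "const_term (cst c * single m 1 * (cst d * single n 1)) =
      const_term (cst c * single m 1) * const_term (cst d * single n 1)" for c d m n
  proof -
    have "cst c * single m 1 * (cst d * single n 1) = single (m + n) (c * d)"
      "cst c * single m 1 = single m c" "cst d * single n 1 = single n d"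
      by (simp_all add: cst_def mult_single)
    moreover have "m + n = 0 \<longleftrightarrow> m = 0 \<and> n = 0"
      by (auto simp: poly_mapping_eq_iff fun_eq_iff lookup_add)
    ultimately show ?thesis
      by (simp add: const_term_def lookup_single when_def)
  qed
  have "const_term (r * r') = const_term r * const_term r'"
    if "r = (\<Sum>m\<in>keys p. cst (lookup p m) * single m 1)"
      "r' = (\<Sum>m\<in>keys q. cst (lookup q m) * single m 1)" for r r'
    unfolding that by (simp only: sum_product const_term_sum *)
  from this[OF kdv_sum_single kdv_sum_single] show ?thesis .
qed

lemma const_term_derivation_ext:
  assumes "\<And>k. const_term (f k) = 0"
  shows "const_term (derivation_ext f p) = 0"
proof -
  interpret derivation "derivation_ext f" by (rule derivation_derivation_ext)
  show ?thesis
    by (induction p rule: kdv_ring_induct)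
       (simp_all add: assms const_term_add const_term_mult add mult)
qed

lemma const_term_dprime [simp]: "const_term (dprime p) = 0"
  unfolding dprime_def by (rule const_term_derivation_ext) simp

section \<open>The KdV hierarchy\<close>

text \<open>The coefficients \<open>S\<^sub>2\<^sub>n\<close> of the diagonal resolvent \<open>V\<close>, normalised by \<open>S\<^sub>0 = 1\<close>. The recursion is
  the first integral \<open>2 V V'' - V'\<^sup>2 - 4 (u + z\<^sup>2) V\<^sup>2 = - 4 z\<^sup>2\<close> of the linear recursion of \<open>KdV_S\<close>;
  it needs no antiderivatives.\<close>
function resolvent_coeff :: "nat \<Rightarrow> kdv_ring" where
  "resolvent_coeff 0 = 1"
| "resolvent_coeff (Suc n) = cst (1/8) *
     ((\<Sum>i\<le>n. 2 * resolvent_coeff i * dprime (dprime (resolvent_coeff (n - i)))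
          - dprime (resolvent_coeff i) * dprime (resolvent_coeff (n - i))
          - 4 * uvar 0 * resolvent_coeff i * resolvent_coeff (n - i))
       - 4 * (\<Sum>i\<in>{1..n}. resolvent_coeff i * resolvent_coeff (Suc n - i)))"
  by pat_completeness auto
termination
  by (relation "measure id") auto

declare resolvent_coeff.simps(2) [simp del]

abbreviation (input) "sq \<equiv> resolvent_coeff"

definition resolvent :: "kdv_ring fps" where
  "resolvent = Abs_fps sq"

lemma resolvent_nth [simp]: "fps_nth resolvent n = sq n"
  by (simp add: resolvent_def)

interpretation fdp: derivation "fps_lift dprime"
  by (rule derivation_fps_lift) (rule dp.derivation_axioms)

abbreviation fd :: "kdv_ring fps \<Rightarrow> kdv_ring fps" where "fd \<equiv> fps_lift dprime"

lemma cst_eq_0_iff: "cst c = 0 \<longleftrightarrow> c = 0"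
  by (auto dest: arg_cong[where f = const_term])

text \<open>At order n + 1 the two extreme terms of the square of \<open>resolvent\<close> are both
  \<open>sq (Suc n)\<close>, because \<open>sq 0 = 1\<close>. Solving for them gives exactly the
  recursion that defines \<open>resolvent_coeff\<close>.\<close>

lemma resolvent_quadratic:
  "4 * resolvent * resolvent = 4 + fps_X * (2 * resolvent * fd (fd resolvent)
     - fd resolvent * fd resolvent - 4 * fps_const (uvar 0) * resolvent * resolvent)"
proof (rule fps_ext)
  let ?V = resolvent and ?u = "fps_const (uvar 0)"
  fix n
  show "fps_nth (4 * ?V * ?V) n = fps_nth (4 + fps_X * (2 * ?V * fd (fd ?V)
     - fd ?V * fd ?V - 4 * ?u * ?V * ?V)) n"
  proof (cases n)
    case 0
    then show ?thesis
      by (simp add: mult.assoc numeral_fps_const)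
  next
    case (Suc m)
    let ?A = "(\<Sum>i\<le>m. 2 * sq i * dprime (dprime (sq (m - i)))
          - dprime (sq i) * dprime (sq (m - i)) - 4 * uvar 0 * sq i * sq (m - i))"
    let ?B = "(\<Sum>i\<in>{1..m}. sq i * sq (Suc m - i))"
    have "8 * sq (Suc m) = cst 8 * (cst (1/8) * (?A - 4 * ?B))"
      by (simp add: resolvent_coeff.simps(2) cst_numeral)
    also have "\<dots> = ?A - 4 * ?B"
      by (simp only: mult.assoc[symmetric] cst_mult[symmetric]) simp
    finally have 8: "8 * sq (Suc m) = ?A - 4 * ?B" .
    have "{0..Suc m} = insert 0 (insert (Suc m) {1..m})"
      by auto
    then have VV: "fps_nth (?V * ?V) (Suc m) = 2 * sq (Suc m) + ?B"
      by (simp add: fps_mult_nth)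
    have 4: "4 * ?V * ?V = fps_const 4 * (?V * ?V)" 
      "4 * ?u * ?V * ?V = fps_const (4 * uvar 0) * (?V * ?V)"
      "2 * ?V * fd (fd ?V) = fps_const 2 * (?V * fd (fd ?V))"
      by (simp_all add: numeral_fps_const mult.assoc fps_const_mult[symmetric] del: fps_const_mult)
    have "fps_nth (fps_X * (2 * ?V * fd (fd ?V) - fd ?V * fd ?V - 4 * ?u * ?V * ?V)) (Suc m) = ?A"
      unfolding 4
      by (simp add: fps_mult_nth[of ?V] fps_mult_nth[of "fd ?V"] atLeast0AtMost
        sum_distrib_left sum_subtractf mult.assoc)
    moreover have "fps_nth (4 * ?V * ?V) (Suc m) = 8 * sq (Suc m) + 4 * ?B"
      unfolding 4 using VV by (simp add: distrib_left)
    ultimately show ?thesis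
      using 8 Suc by (simp add: numeral_fps_const)
  qed
qed

lemma resolvent_neq_0 [simp]: "resolvent \<noteq> 0"
proof
  assume "resolvent = 0"
  then have "fps_nth resolvent 0 = 0" by simp
  then show False by simp
qed

text \<open>The derivative of \<open>resolvent_quadratic\<close> is this identity multiplied by
  \<open>2 * resolvent\<close>, and that factor can be cancelled.\<close>

lemma resolvent_linear:
  "4 * fd resolvent = fps_X * (fd (fd (fd resolvent)) - 4 * fps_const (uvar 0) * fd resolvent
     - 2 * fps_const (uvar 1) * resolvent)"
proof -
  let ?V = resolvent and ?u = "fps_const (uvar 0)"
  have u: "fd ?u = fps_const (uvar 1)"
    by (simp add: fps_lift_const dp.derivation_axioms)
  have X: "fd fps_X = 0"
    by (simp add: fps_lift_X dp.derivation_axioms)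
  have "fd (4 * ?V * ?V) = fd (4 + fps_X * (2 * ?V * fd (fd ?V)
     - fd ?V * fd ?V - 4 * ?u * ?V * ?V))"
    by (simp only: resolvent_quadratic)
  then have "(2 * ?V) * (4 * fd ?V) = (2 * ?V) * (fps_X * (fd (fd (fd ?V)) - 4 * ?u * fd ?V
     - 2 * fps_const (uvar 1) * ?V))"
    by (simp add: fdp.add fdp.mult fdp.diff u X algebra_simps)
  then show ?thesis
    by (subst (asm) mult_left_cancel) simp_all
qed

lemma resolvent_coeff_linear:
  "4 * dprime (sq (Suc n)) = dprime (dprime (dprime (sq n))) - 4 * uvar 0 * dprime (sq n)
     - 2 * uvar 1 * sq n"
proof -
  have *: "4 * fd resolvent = fps_const 4 * fd resolvent"
    "4 * fps_const (uvar 0) * fd resolvent = fps_const (4 * uvar 0) * fd resolvent"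
    "2 * fps_const (uvar 1) * resolvent = fps_const (2 * uvar 1) * resolvent"
    by (simp_all add: numeral_fps_const)
  show ?thesis
    using arg_cong[OF resolvent_linear, of "\<lambda>F. fps_nth F (Suc n)"] unfolding * by simp
qed

lemma resolvent_coeff_1: "sq 1 = cst (-1/2) * uvar 0"
proof -
  have "sq 1 = cst (1/8) * (cst (-4) * uvar 0)"
    by (simp add: resolvent_coeff.simps(2) cst_numeral cst_minus)
  then show ?thesis
    by (simp only: mult.assoc[symmetric] cst_mult[symmetric]) simp
qed

lemma const_term_resolvent_coeff: "const_term (sq n) = (if n = 0 then 1 else 0)"
proof (induction n rule: less_induct)
  case (less n)
  show ?case
  proof (cases n)
    case (Suc m)
    have "const_term (sq i) = 0" if "i \<in> {1..m}" for i
      using less[of i] that Suc by simp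
    then have "const_term (\<Sum>i\<in>{1..m}. sq i * sq (Suc m - i)) = 0"
      by (simp add: const_term_sum const_term_mult)
    then show ?thesis
      unfolding Suc resolvent_coeff.simps(2)
      by (simp add: const_term_scale const_term_diff const_term_sum const_term_mult[of "dprime _"]
          const_term_mult[of _ "dprime _"] const_term_mult[of 4] const_term_mult[of "4 * uvar 0 * _"]
          const_term_mult[of "4 * uvar 0"] const_term_mult[of _ "uvar 0"])
  qed simp
qed

section \<open>Agreement with the recursion of \<open>KdV_S\<close>\<close>

lemma antider_eqI:
  assumes "dprime p = q" "const_term p = 0"
  shows "antider q = p"
  unfolding antider_def
proof (rule the_equality)
  fix p' assume "dprime p' = q \<and> const_term p' = 0"
  then show "p' = p"
    using assms dprime_inj[of p' p] by simp
qed (simp add: assms)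

text \<open>By \<open>resolvent_coeff_linear\<close>, \<open>sq (Suc m)\<close> is a primitive of
  the right-hand side of the recursion, and its constant term is zero. Such a primitive is unique,
  so it is the one that \<open>antider\<close> selects.\<close>

lemma KdV_S_eq: "n > 0 \<Longrightarrow> KdV_S n = sq n"
proof (induction n)
  case (Suc m)
  show ?case
  proof (cases "m = 0")
    case False
    then have IH: "KdV_S m = sq m"
      using Suc by simp
    have "dprime (sq (Suc m)) = cst (1/4) * (cst 4 * dprime (sq (Suc m)))"
      by (simp only: mult.assoc[symmetric] cst_mult[symmetric]) simp
    also have "\<dots> = cst (1/4) * (dprime ^^ 3) (sq m) - cst (1/4) * cst 4 * (uvar 0 * dprime (sq m))
                    - cst (1/4) * cst 2 * (uvar 1 * sq m)"
      by (simp only: cst_numeral resolvent_coeff_linear)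
         (simp add: algebra_simps numeral_3_eq_3)
    also have "\<dots> = cst (1/4) * (dprime ^^ 3) (sq m) - uvar 0 * dprime (sq m) - cst (1/2) * uvar 1 * sq m"
      by (simp only: cst_mult[symmetric]) (simp add: mult.assoc)
    finally have "antider (cst (1/4) * (dprime ^^ 3) (sq m) - uvar 0 * dprime (sq m)
        - cst (1/2) * uvar 1 * sq m) = sq (Suc m)"
      by (intro antider_eqI) (simp_all add: const_term_resolvent_coeff)
    then show ?thesis
      using False by (simp add: IH)
  qed (use resolvent_coeff_1 in simp)
qed simp

lemma S_eq: "n > 0 \<Longrightarrow> S (2 * n) = sq n"
  by (simp add: S_def KdV_S_eq)

text \<open>\<open>flow i\<close> is the KdV flow \<partial>_(2i-1). The additional index 0 gives
  the zero derivation, because \<open>sq 0 = 1\<close>, and is a convenient start for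
  inductions.\<close>

definition flow :: "nat \<Rightarrow> kdv_ring \<Rightarrow> kdv_ring" where
  "flow i = derivation_ext (\<lambda>k. (dprime ^^ Suc k) (sq i))"

lemma kdv_flow_eq: "kdv_flow (2 * i + 1) = flow (Suc i)"
proof -
  have "S (2 * i + 1 + 1) = sq (Suc i)"
    using S_eq[of "Suc i"] by (simp add: algebra_simps)
  then show ?thesis
    unfolding kdv_flow_def flow_def by simp
qed

interpretation flow: derivation "flow i" for i
  unfolding flow_def by (rule derivation_derivation_ext)

lemma flow_cst [simp]: "flow i (cst c) = 0"
  and flow_scale: "flow i (cst c * p) = cst c * flow i p"
  and flow_uvar: "flow i (uvar k) = (dprime ^^ Suc k) (sq i)"
  by (simp_all add: flow_def derivation_ext_scale)

lemma flow_0 [simp]: "flow 0 p = 0"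
proof -
  have "(dprime ^^ Suc k) 1 = 0" for k
    by (induction k) simp_all
  then show ?thesis
    by (simp add: flow_def derivation_ext_def del: funpow.simps)
qed

lemma const_term_flow [simp]: "const_term (flow i p) = 0"
  unfolding flow_def by (rule const_term_derivation_ext) simp

lemma flow_dprime: "flow i (dprime p) = dprime (flow i p)"
  unfolding flow_def dprime_def by (rule derivation_ext_commute) (simp add: dprime_def[symmetric])

text \<open>Since S_2 = -u/2, the formula for \<partial>_1 on the generators gives
  \<open>dprime\<close> with the factor -1/2. The kernel is that of \<open>dprime\<close>, which is
  what \<open>flow_1_inj\<close> uses.\<close>

lemma flow_1: "flow 1 p = cst (-1/2) * dprime p"
proof (rule derivation_eqI[OF flow.derivation_axioms])
  show "derivation (\<lambda>p. cst (-1/2) * dprime p)"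
    by standard (simp_all only: dp.add dp.mult distrib_left distrib_right mult_ac)
  have "(dprime ^^ k) (sq 1) = cst (-1/2) * uvar k" for k
    by (induction k) (simp_all only: funpow.simps id_apply comp_apply resolvent_coeff_1 dprime_scale dprime_uvar)
  then show "flow 1 (uvar k) = cst (-1/2) * dprime (uvar k)" for k
    by (simp only: flow_uvar dprime_uvar)
  show "flow 1 (cst c) = cst (-1/2) * dprime (cst c)" for c
    by simp
qed

text \<open>Induction on n. Both sides have zero constant term, so it suffices to compare their
  images under \<open>dprime\<close>, where the linear recursion applies to all coefficients of
  index \<open>Suc i\<close>, \<open>Suc n\<close> and n + 2.\<close>

lemma flow_resolvent_coeff_shift:
  "2 * (flow (Suc i) (sq n) - flow i (sq (Suc n))) = dprime (sq i) * sq n - sq i * dprime (sq n)"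
proof (induction n)
  case 0
  have "2 * flow i (sq (Suc 0)) = cst (2 * (-1/2)) * dprime (sq i)"
    by (simp only: cst_mult cst_numeral resolvent_coeff_1[unfolded One_nat_def] flow_scale flow_uvar) simp
  then show ?case
    by (simp add: cst_minus)
next
  case (Suc n)
  define a where "a = sq i"
  define b where "b = sq n"
  define c where "c = sq (Suc n)"
  define d where "d = sq (Suc i)"
  define f where "f = flow i c"
  define g where "g = flow (Suc i) b"
  define u where "u = uvar 0"
  have u1: "uvar 1 = dprime u"
    by (simp add: u_def)
  have IH: "2 * (g - f) = dprime a * b - a * dprime b"
    using Suc by (simp add: a_def b_def c_def f_def g_def)
  have c: "4 * dprime c = dprime (dprime (dprime b)) - 4 * u * dprime b - 2 * dprime u * b"
    and d: "4 * dprime d = dprime (dprime (dprime a)) - 4 * u * dprime a - 2 * dprime u * a"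
    unfolding a_def b_def c_def d_def u1[symmetric] unfolding u_def
    by (rule resolvent_coeff_linear)+
  have e: "4 * dprime (sq (Suc (Suc n))) = dprime (dprime (dprime c)) - 4 * u * dprime c - 2 * dprime u * c"
    unfolding c_def u1[symmetric] unfolding u_def by (rule resolvent_coeff_linear)
  have "4 * dprime (flow i (sq (Suc (Suc n)))) = flow i (4 * dprime (sq (Suc (Suc n))))"
    by (simp add: flow_dprime flow.mult)
  \<comment> \<open>The last two terms come from the flow acting on u itself:
    \<open>flow i u = dprime a\<close>.\<close>
  also have "\<dots> = dprime (dprime (dprime f)) - 4 * u * dprime f - 2 * dprime u * f
      - 4 * dprime a * dprime c - 2 * dprime (dprime a) * c"
    unfolding e
    by (simp add: flow.diff flow.mult flow_dprime f_def[symmetric])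
       (simp add: u_def flow_uvar a_def algebra_simps)
  finally have 1: "4 * dprime (flow i (sq (Suc (Suc n)))) = \<dots>" .
  have "4 * dprime (flow (Suc i) c) = flow (Suc i) (4 * dprime c)"
    by (simp add: flow_dprime flow.mult)
  also have "\<dots> = dprime (dprime (dprime g)) - 4 * u * dprime g - 2 * dprime u * g
      - 4 * dprime d * dprime b - 2 * dprime (dprime d) * b"
    unfolding c
    by (simp add: flow.diff flow.mult flow_dprime g_def[symmetric])
       (simp add: u_def flow_uvar d_def algebra_simps)
  finally have 2: "4 * dprime (flow (Suc i) c) = \<dots>" .
  note ders = dp.add dp.diff dp.mult dp.numeral
  have IH1: "2 * (dprime g - dprime f) = dprime (dprime a) * b - a * dprime (dprime b)"
    using arg_cong[OF IH, of dprime] by (simp add: ders algebra_simps)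
  have IH3: "2 * (dprime (dprime (dprime g)) - dprime (dprime (dprime f))) =
      dprime (dprime (dprime (dprime a))) * b + 2 * dprime (dprime (dprime a)) * dprime b
      - 2 * dprime a * dprime (dprime (dprime b)) - a * dprime (dprime (dprime (dprime b)))"
    using arg_cong[OF IH1, of "\<lambda>x. dprime (dprime x)"] by (simp add: ders algebra_simps)
  have c': "4 * dprime (dprime c) = dprime (dprime (dprime (dprime b))) - 4 * u * dprime (dprime b)
      - 6 * dprime u * dprime b - 2 * dprime (dprime u) * b"
    using arg_cong[OF c, of dprime] by (simp add: ders algebra_simps)
  have d': "4 * dprime (dprime d) = dprime (dprime (dprime (dprime a))) - 4 * u * dprime (dprime a)
      - 6 * dprime u * dprime a - 2 * dprime (dprime u) * a"
    using arg_cong[OF d, of dprime] by (simp add: ders algebra_simps)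
  \<comment> \<open>The factor 8 makes the derivatives of \<open>c\<close> and \<open>d\<close>
    appear with the factor 4 of their recursions, so nothing has to be divided before the
    end.\<close>
  have "8 * dprime (2 * (flow (Suc i) c - flow i (sq (Suc (Suc n))))) =
      2 * (2 * (4 * dprime (flow (Suc i) c) - 4 * dprime (flow i (sq (Suc (Suc n))))))"
    by (simp add: ders algebra_simps)
  also have "\<dots> = 2 * (2 * (dprime (dprime (dprime g)) - dprime (dprime (dprime f)))
      - 4 * u * (2 * (dprime g - dprime f)) - 2 * dprime u * (2 * (g - f))
      - 2 * (4 * dprime d) * dprime b - 4 * dprime (dprime d) * b
      + 2 * (dprime a * (4 * dprime c)) + 4 * dprime (dprime a) * c)"
    unfolding 1 2 by (simp add: algebra_simps)
  also have "\<dots> = 2 * (4 * dprime (dprime a) * c - a * (4 * dprime (dprime c)))"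
    unfolding IH IH1 IH3 c c' d d' by (simp add: algebra_simps)
  also have "\<dots> = 8 * dprime (dprime a * c - a * dprime c)"
    by (simp add: ders algebra_simps)
  finally have "8 * dprime (2 * (flow (Suc i) c - flow i (sq (Suc (Suc n))))) =
      8 * dprime (dprime a * c - a * dprime c)" .
  then have "dprime (2 * (flow (Suc i) c - flow i (sq (Suc (Suc n))))) =
      dprime (dprime a * c - a * dprime c)"
    by simp
  then show ?case
    unfolding a_def c_def
    by (rule dprime_inj) (simp add: const_term_diff const_term_mult const_term_resolvent_coeff)
qed

text \<open>In the sum of the shift relation and its copy with i and n exchanged, the right-hand
  sides cancel. This reduces the pair (i + 1, n) to the pair (i, n + 1).\<close>

lemma flow_resolvent_coeff_symmetric: "flow i (sq n) = flow n (sq i)"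
proof (induction i arbitrary: n)
  case (Suc i)
  have "2 * (flow (Suc i) (sq n) - flow i (sq (Suc n))) + 2 * (flow (Suc n) (sq i) - flow n (sq (Suc i))) = 0"
    unfolding flow_resolvent_coeff_shift by (simp add: algebra_simps)
  then have "2 * (flow (Suc i) (sq n) - flow n (sq (Suc i))) = 2 * 0"
    using Suc[of "Suc n"] by (simp add: algebra_simps)
  then show ?case
    by simp
qed simp

text \<open>On the generators the claim is \<open>flow_resolvent_coeff_symmetric\<close>
  differentiated k + 1 times.\<close>

lemma flow_commute: "flow i (flow j p) = flow j (flow i p)"
proof -
  have "flow i ((dprime ^^ k) q) = (dprime ^^ k) (flow i q)" for i k q
    by (induction k) (simp_all add: flow_dprime)
  then have "flow i ((dprime ^^ Suc k) (sq j)) = flow j ((dprime ^^ Suc k) (sq i))" for k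
    by (simp only: flow_resolvent_coeff_symmetric)
  then show ?thesis
    unfolding flow_def by (intro derivation_ext_commute) simp
qed

text \<open>Serves to identify elements known only through \<partial>_1 and their constant term, as
  \<open>zeta\<close> is.\<close>

lemma flow_1_inj:
  assumes "flow 1 p = flow 1 q" "const_term p = const_term q"
  shows "p = q"
proof -
  have "dprime p = dprime q"
    using assms(1) unfolding flow_1 by (simp add: cst_eq_0_iff)
  then show ?thesis
    using assms(2) by (rule dprime_inj)
qed

section \<open>Closed one-forms\<close>

definition resolvent_inv :: "kdv_ring fps" where
  "resolvent_inv = fps_right_inverse resolvent 1"

lemma resolvent_mult_inv: "resolvent * resolvent_inv = 1"
  unfolding resolvent_inv_def by (rule fps_right_inverse) simp

text \<open>With q for \<open>fps_X\<close>, this is q^(1-k) times the part of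
  \<open>resolvent\<close> of order at least k.\<close>

definition resolvent_tail :: "nat \<Rightarrow> kdv_ring fps" where
  "resolvent_tail k = fps_X * Abs_fps (\<lambda>n. sq (k + n))"

text \<open>For fixed \<open>n\<close> the form \<open>\<Sum>\<^sub>k omega n k dt\<^sub>2\<^sub>k\<^sub>-\<^sub>1\<close> is closed. In genus \<open>g\<close>, where \<open>V\<close> is up to normalisation
  \<open>\<Prod>\<^sub>j (1 - x\<^sub>j / z\<^sup>2)\<close> for the Dubrovin divisor \<open>(x\<^sub>j, y\<^sub>j)\<close>, it is \<open>\<Sum>\<^sub>j x\<^sub>j\<^sup>g\<^sup>+\<^sup>n\<^sup>-\<^sup>1 dx\<^sub>j / y\<^sub>j\<close>.\<close>
definition omega :: "nat \<Rightarrow> nat \<Rightarrow> kdv_ring" where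
  "omega n k = fps_nth (resolvent_inv * resolvent_tail k) n"

abbreviation omega_fps :: "nat \<Rightarrow> kdv_ring fps" where
  "omega_fps k \<equiv> resolvent_inv * resolvent_tail k"

lemma resolvent_mult_omega: "resolvent * omega_fps k = resolvent_tail k"
  by (simp add: mult.assoc[symmetric] resolvent_mult_inv)

lemma resolvent_tail_0: "resolvent_tail 0 = fps_X * resolvent"
  by (simp add: resolvent_tail_def resolvent_def)

lemma resolvent_tail_Suc: "resolvent_tail k = fps_X * (fps_const (sq k) + resolvent_tail (Suc k))"
proof -
  have "Abs_fps (\<lambda>n. sq (k + n)) = fps_const (sq k) + fps_X * Abs_fps (\<lambda>n. sq (Suc k + n))"
  proof (rule fps_ext)
    fix n
    show "fps_nth (Abs_fps (\<lambda>n. sq (k + n))) n =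
        fps_nth (fps_const (sq k) + fps_X * Abs_fps (\<lambda>n. sq (Suc k + n))) n"
      by (cases n) simp_all
  qed
  then show ?thesis
    by (simp only: resolvent_tail_def)
qed

lemma resolvent_tail_1: "resolvent_tail 1 = resolvent - 1"
proof (rule fps_ext)
  fix n
  show "fps_nth (resolvent_tail 1) n = fps_nth (resolvent - 1) n"
    by (cases n) (simp_all add: resolvent_tail_def)
qed

lemma omega_fps_1: "omega_fps 1 = 1 - resolvent_inv"
  unfolding resolvent_tail_1 using resolvent_mult_inv by (simp add: algebra_simps)

lemma const_term_omega: "const_term (omega n (Suc k)) = 0"
proof -
  have "const_term (fps_nth (resolvent_tail (Suc k)) m) = 0" for m
    by (simp add: resolvent_tail_def const_term_resolvent_coeff)
  then show ?thesis
    by (simp add: omega_def fps_mult_nth const_term_sum const_term_mult)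
qed

abbreviation fflow :: "nat \<Rightarrow> kdv_ring fps \<Rightarrow> kdv_ring fps" where
  "fflow k \<equiv> fps_lift (flow k)"

interpretation fflow: derivation "fps_lift (flow k)" for k
  by (rule derivation_fps_lift) (rule flow.derivation_axioms)

lemma fd_X [simp]: "fd fps_X = 0"
  by (simp add: fps_lift_X dp.derivation_axioms)

lemma fd_const: "fd (fps_const a) = fps_const (dprime a)"
  by (simp add: fps_lift_const dp.derivation_axioms)

lemma fflow_resolvent_shift:
  "fps_X * (2 * fflow (Suc k) resolvent) = 2 * fflow k resolvent +
     fps_X * (fps_const (dprime (sq k)) * resolvent - fps_const (sq k) * fd resolvent)"
proof (rule fps_ext)
  fix n
  have 2: "2 * fflow k resolvent = fps_const 2 * fflow k resolvent" for k
    by (simp add: numeral_fps_const)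
  show "fps_nth (fps_X * (2 * fflow (Suc k) resolvent)) n = fps_nth (2 * fflow k resolvent +
     fps_X * (fps_const (dprime (sq k)) * resolvent - fps_const (sq k) * fd resolvent)) n"
    unfolding 2
    using flow_resolvent_coeff_shift[of k] by (cases n) (simp_all add: algebra_simps)
qed

text \<open>For k = 0 both sides vanish, since H_0 is q times \<open>resolvent\<close>, where H_k
  stands for \<open>resolvent_tail k\<close>. After multiplication by q,
  \<open>fflow_resolvent_shift\<close> and \<open>resolvent_tail_Suc\<close> give both sides the
  same recursion in k.\<close>

lemma fflow_resolvent:
  "2 * fflow k resolvent = resolvent_tail k * fd resolvent - fd (resolvent_tail k) * resolvent"
proof (induction k)
  case 0
  have *: "fflow 0 resolvent = 0"
    by (simp add: fps_eq_iff)
  show ?case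
    unfolding * by (simp add: resolvent_tail_0 fdp.mult)
next
  case (Suc k)
  have "fps_X * (2 * fflow (Suc k) resolvent) =
      fps_X * (resolvent_tail (Suc k) * fd resolvent - fd (resolvent_tail (Suc k)) * resolvent)"
    unfolding fflow_resolvent_shift Suc
    unfolding resolvent_tail_Suc[of k]
    by (simp add: fdp.mult fdp.add fd_const algebra_simps)
  then show ?case
    by (subst (asm) mult_left_cancel) simp_all
qed

text \<open>Write V for \<open>resolvent\<close> and H for \<open>resolvent_tail k\<close>. By
  \<open>fflow_resolvent\<close>, (H/V)' = (H'V - HV')/V^2 is -2/V^2 times the k-th flow of V, hence
  twice the k-th flow of 1/V, and \<open>omega_fps 1\<close> is 1 - 1/V.\<close>

lemma fd_omega: "fd (omega_fps k) = - (2 * fflow k (omega_fps 1))"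
proof -
  let ?V = resolvent and ?T = resolvent_inv and ?H = "resolvent_tail k" and ?g = "omega_fps k"
  have g: "fd ?V * ?g + ?V * fd ?g = fd ?H"
    using arg_cong[OF resolvent_mult_omega[of k], of fd] by (simp only: fdp.mult)
  have T: "fflow k ?V * ?T + ?V * fflow k ?T = 0"
    using arg_cong[OF resolvent_mult_inv, of "fflow k"] by (simp add: fflow.mult)
  have "?V * ?V * fd ?g = ?V * fd ?H - fd ?V * (?V * ?g)"
    by (simp add: g[symmetric] algebra_simps)
  also have "\<dots> = - (2 * fflow k ?V)"
    unfolding resolvent_mult_omega fflow_resolvent by (simp add: algebra_simps)
  also have "fflow k ?V = ?V * (fflow k ?V * ?T)"
    using resolvent_mult_inv by (simp add: mult.left_commute)
  also have "\<dots> = - (?V * (?V * fflow k ?T))"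
    using T by (simp add: eq_neg_iff_add_eq_0 distrib_left[symmetric])
  also have "- (2 * - (?V * (?V * fflow k ?T))) = ?V * ?V * - (2 * fflow k (omega_fps 1))"
    unfolding omega_fps_1 by (simp add: fflow.diff algebra_simps)
  finally show ?thesis
    by (subst (asm) mult_left_cancel) simp_all
qed

lemma flow_1_double: "2 * flow 1 p = - dprime p"
proof -
  have "2 * flow 1 p = cst (2 * (-1/2)) * dprime p"
    by (simp only: cst_mult cst_numeral flow_1 mult.assoc)
  then show ?thesis
    by (simp add: cst_minus)
qed

lemma flow_1_omega: "flow 1 (omega n k) = flow k (omega n 1)"
proof -
  have 2: "2 * fflow k F = fps_const 2 * fflow k F" for k F
    by (simp add: numeral_fps_const)
  have "2 * flow 1 (omega n k) = 2 * flow k (omega n 1)"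
    unfolding flow_1_double
    using arg_cong[OF fd_omega[of k], of "\<lambda>F. fps_nth F n"] unfolding 2 omega_def by simp
  then show ?thesis
    by simp
qed

text \<open>By \<open>flow_1_omega\<close> and commutativity, \<partial>_1 sends both sides to
  \<open>flow j (flow k (omega n 1))\<close>, and both have zero constant term.\<close>

lemma omega_closed: "flow j (omega n k) = flow k (omega n j)"
proof (rule flow_1_inj)
  show "flow 1 (flow j (omega n k)) = flow 1 (flow k (omega n j))"
    by (simp only: flow_commute[of 1] flow_1_omega) (rule flow_commute)
qed simp

text \<open>The second kind differential \<open>\<Sum>\<^sub>k \<zeta>\<^sub>n\<^sub>k dt\<^sub>k\<close> differs from a multiple of \<open>omega\<close> by the differential of
  a coefficient of \<open>z\<^sup>-\<^sup>4 V \<partial>\<^sub>q (V' / V)\<close>, \<open>q = z\<^sup>-\<^sup>2\<close>.\<close>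
definition potential_fps :: "kdv_ring fps" where
  "potential_fps = fps_X * fps_X * (fd (fps_deriv resolvent) - fd resolvent * fps_deriv resolvent * resolvent_inv)"

definition potential :: "nat \<Rightarrow> kdv_ring" where
  "potential n = fps_nth potential_fps n"

text \<open>The terms with second derivatives of \<open>resolvent\<close> are eliminated by
  \<open>resolvent_quadratic\<close> and its derivative in the variable of the power series.\<close>

lemma fd_potential:
  "fd potential_fps = - (2 * (resolvent + 2 * (fps_X * fps_deriv resolvent_inv) - resolvent_inv))"
proof -
  let ?V = resolvent and ?T = resolvent_inv and ?u = "fps_const (uvar 0)" and ?X = "fps_X :: kdv_ring fps"
  define V1 where "V1 = fd ?V"
  define V2 where "V2 = fd V1"
  define W where "W = fps_deriv ?V"
  define W1 where "W1 = fd W"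
  define W2 where "W2 = fd W1"
  have W1: "fps_deriv V1 = W1" and W2: "fps_deriv V2 = W2"
    by (simp_all add: W_def W1_def W2_def V1_def V2_def fps_lift_deriv dp.derivation_axioms)
  have VT: "?V * ?T = 1"
    by (rule resolvent_mult_inv)
  have T1: "?V * fd ?T = - (V1 * ?T)"
    using arg_cong[OF resolvent_mult_inv, of fd] by (simp add: fdp.mult V1_def eq_neg_iff_add_eq_0 add.commute)
  have Tq: "?V * fps_deriv ?T = - (W * ?T)"
    using arg_cong[OF resolvent_mult_inv, of fps_deriv]
    by (simp add: W_def eq_neg_iff_add_eq_0 add.commute mult.commute)
  \<comment> \<open>The bracket of \<open>resolvent_quadratic\<close>; multiplied by q it equals
    4V^2 - 4.\<close>
  define B where "B = 2 * ?V * V2 - V1 * V1 - 4 * ?u * ?V * ?V"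
  have Q: "?X * B = 4 * ?V * ?V - 4"
    using resolvent_quadratic by (simp add: B_def V1_def V2_def)
  have Bq: "fps_deriv B = 2 * W * V2 + 2 * ?V * W2 - 2 * V1 * W1 - 8 * ?u * ?V * W"
    unfolding B_def
    by (simp add: W1 W2 W_def[symmetric] numeral_fps_const algebra_simps)
  have dQ: "B + ?X * fps_deriv B = 8 * ?V * W"
    using arg_cong[OF Q, of fps_deriv]
    by (simp add: W_def[symmetric] numeral_fps_const algebra_simps)
  have "?V * ?V * fd potential_fps = ?X * ?X * (?V * ?V * W2 - ?V * V2 * W * (?V * ?T)
      - ?V * V1 * W1 * (?V * ?T) - ?V * V1 * W * (?V * fd ?T))"
    unfolding potential_fps_def
    by (simp add: fdp.mult fdp.diff V1_def[symmetric] V2_def[symmetric] W_def[symmetric]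
        W1_def[symmetric] W2_def[symmetric] algebra_simps)
  also have "?V * V1 * W * (?V * fd ?T) = - (V1 * V1 * W * (?V * ?T))"
    unfolding T1 by (simp add: algebra_simps)
  finally have R: "?V * ?V * fd potential_fps = ?X * ?X * (?V * ?V * W2 - ?V * V2 * W
      - ?V * V1 * W1 + V1 * V1 * W)"
    by (simp add: VT)
  \<comment> \<open>In the combination of \<open>?V * fps_deriv B\<close> and
    \<open>2 * W * B\<close> the terms containing u cancel, which leaves twice the bracket of
    \<open>R\<close>.\<close>
  have "2 * (?V * ?V * fd potential_fps) = ?X * ?V * (?X * fps_deriv B) - 2 * W * ?X * (?X * B)"
    unfolding R Bq unfolding B_def by (simp add: algebra_simps)
  also have "?X * fps_deriv B = 8 * ?V * W - B"
    using dQ by (simp add: algebra_simps)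
  also have "?X * ?V * (8 * ?V * W - B) - 2 * W * ?X * (?X * B) =
      8 * ?X * ?V * ?V * W - ?V * (?X * B) - 2 * W * ?X * (?X * B)"
    by (simp add: algebra_simps)
  also have "\<dots> = 2 * (- (2 * (?V * ?V * ?V - 2 * ?X * W - ?V)))"
    unfolding Q by (simp add: algebra_simps)
  also have "?V * ?V * ?V - 2 * ?X * W - ?V = ?V * ?V * ?V - 2 * ?X * W * (?V * ?T) - ?V * (?V * ?T)"
    by (simp add: VT)
  also have "\<dots> = ?V * ?V * (?V + 2 * (?X * fps_deriv ?T) - ?T)"
    using arg_cong[OF Tq, of "\<lambda>F. 2 * ?X * (?V * F)"] by (simp add: algebra_simps)
  finally have "(2 * (?V * ?V)) * fd potential_fps =
      (2 * (?V * ?V)) * (- (2 * (?V + 2 * (?X * fps_deriv ?T) - ?T)))"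
    by (simp add: algebra_simps)
  then show ?thesis
    by (subst (asm) mult_left_cancel) simp_all
qed

text \<open>The coefficient of q^n in \<open>fd_potential\<close>. For positive n the coefficient of
  \<open>resolvent_inv\<close> is \<open>- omega n 1\<close>, and \<open>fps_X * fps_deriv\<close>
  multiplies it by n, which produces the factor 2n - 1.\<close>

lemma resolvent_coeff_eq_potential:
  assumes "n > 0"
  shows "sq n = flow 1 (potential n) + of_nat (2 * n - 1) * omega n 1"
proof -
  let ?t = "fps_nth resolvent_inv n"
  have X: "fps_nth (fps_X * fps_deriv resolvent_inv) n = of_nat n * ?t"
    using assms by (cases n) (simp_all add: algebra_simps)
  have "fps_nth (fd potential_fps) n = - (2 * (sq n + 2 * (of_nat n * ?t) - ?t))"
    unfolding fd_potential by (simp add: X numeral_fps_const)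
  then have "2 * flow 1 (potential n) = 2 * (sq n + 2 * (of_nat n * ?t) - ?t)"
    unfolding flow_1_double potential_def by simp
  then have "flow 1 (potential n) = sq n + 2 * (of_nat n * ?t) - ?t"
    by (subst (asm) mult_left_cancel) simp_all
  moreover have w: "omega n 1 = - ?t"
    using assms unfolding omega_def omega_fps_1 by simp
  moreover have c: "(of_nat (2 * n - 1) :: kdv_ring) = 2 * of_nat n - 1"
    using assms by (simp add: of_nat_diff)
  ultimately show ?thesis
    unfolding w c by (simp add: algebra_simps)
qed

text \<open>Applying \<open>flow k\<close> to \<open>resolvent_coeff_eq_potential\<close> shows that
  the right-hand side of \<open>zeta_eq\<close> has the image under \<partial>_1 required of
  \<open>zeta\<close>. It thus supplies the existence that the definite description needs;
  uniqueness is \<open>flow_1_inj\<close>.\<close>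

lemma
  assumes "n > 0" "k > 0"
  shows zeta_eq: "zeta (2 * k - 1) (2 * n - 1) = flow k (potential n) + of_nat (2 * n - 1) * omega n k"
    and flow_1_zeta: "flow 1 (zeta (2 * k - 1) (2 * n - 1)) = flow k (sq n)"
    and const_term_zeta: "const_term (zeta (2 * k - 1) (2 * n - 1)) = 0"
proof -
  let ?z = "flow k (potential n) + of_nat (2 * n - 1) * omega n k"
  have "2 * (k - 1) + 1 = 2 * k - 1" "Suc (k - 1) = k"
    using assms by simp_all
  then have k: "kdv_flow (2 * k - 1) = flow k" and 1: "kdv_flow 1 = flow 1"
    using kdv_flow_eq[of "k - 1"] kdv_flow_eq[of 0] by simp_all
  have n: "S (2 * n - 1 + 1) = sq n"
    using assms S_eq[of n] by simp
  have of_nat: "flow i (of_nat m * p) = of_nat m * flow i p" for i m p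
    by (simp add: flow.mult)
  have "flow 1 ?z = flow k (flow 1 (potential n) + of_nat (2 * n - 1) * omega n 1)"
    by (simp only: flow.add of_nat flow_commute[of 1 k] flow_1_omega)
  then have z: "flow 1 ?z = flow k (sq n)"
    using assms resolvent_coeff_eq_potential[of n] by (simp only:)
  have c: "const_term ?z = 0"
    using assms const_term_omega[of n "k - 1"] by (simp add: const_term_add const_term_mult)
  show eq: "zeta (2 * k - 1) (2 * n - 1) = ?z"
    unfolding zeta_def k 1 n
  proof (rule the_equality)
    fix p assume "flow 1 p = flow k (sq n) \<and> const_term p = 0"
    then show "p = ?z"
      using z c flow_1_inj[of p ?z] by simp
  qed (use z c in simp)
  show "flow 1 (zeta (2 * k - 1) (2 * n - 1)) = flow k (sq n)"
    "const_term (zeta (2 * k - 1) (2 * n - 1)) = 0"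
    unfolding eq by (rule z c)+
qed

section \<open>Recursions between the closed forms, and Newton's identities\<close>

lemma omega_0 [simp]: "omega 0 k = 0"
  by (simp add: omega_def resolvent_tail_def)

lemma omega_1: "omega 1 k = sq k"
proof -
  have "fps_nth resolvent_inv 0 = 1"
    using arg_cong[OF resolvent_mult_inv, of "\<lambda>F. fps_nth F 0"] by simp
  then show ?thesis
    by (simp add: omega_def resolvent_tail_def fps_mult_nth)
qed

text \<open>Up to the sign (-1)^(n-1), this is the Pieri rule that splits e_n h_k into two hook
  Schur functions.\<close>

lemma omega_Suc:
  assumes "n > 0"
  shows "omega (Suc n) k = omega n (Suc k) - omega n 1 * omega 1 k"
proof -
  have "omega_fps k = fps_X * (resolvent_inv * fps_const (sq k) + omega_fps (Suc k))"
    by (subst resolvent_tail_Suc) (simp add: algebra_simps)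
  then have "omega (Suc n) k = fps_nth resolvent_inv n * sq k + omega n (Suc k)"
    by (simp add: omega_def)
  moreover have "omega n 1 = - fps_nth resolvent_inv n"
    using assms unfolding omega_def omega_fps_1 by simp
  ultimately show ?thesis
    unfolding omega_1 by simp
qed

text \<open>Iterating \<open>omega_Suc\<close> moves a shift of n to a shift of k. The correction
  terms will match those in the expansion of a bordered minor.\<close>

lemma omega_add:
  assumes "n > 0"
  shows "omega (n + m) k = omega n (k + m) - (\<Sum>j<m. omega n (Suc j) * omega (m - j) k)"
proof (induction m arbitrary: k)
  case (Suc m)
  have "omega (n + Suc m) k = omega (n + m) (Suc k) - omega (n + m) 1 * omega 1 k"
    using omega_Suc[of "n + m"] assms by simp
  also have "\<dots> = omega n (k + Suc m) - omega n (Suc m) * omega 1 k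
      - (\<Sum>j<m. omega n (Suc j) * (omega (m - j) (Suc k) - omega (m - j) 1 * omega 1 k))"
    unfolding Suc by (simp add: algebra_simps sum_subtractf sum_distrib_left)
  also have "(\<Sum>j<m. omega n (Suc j) * (omega (m - j) (Suc k) - omega (m - j) 1 * omega 1 k)) =
      (\<Sum>j<m. omega n (Suc j) * omega (Suc m - j) k)"
    by (intro sum.cong refl) (simp add: omega_Suc Suc_diff_le)
  finally show ?case
    by (simp add: algebra_simps)
qed simp

text \<open>Newton's identities: the traces of the matrix \<open>omega\<close> over its antidiagonals are the power sums.\<close>
definition power_sum :: "nat \<Rightarrow> kdv_ring" where
  "power_sum m = (\<Sum>j<m. omega (m - j) (Suc j))"

text \<open>After exchanging the sums, the inner sum for fixed j is the coefficient of q^(n-j) in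
  \<open>omega_fps (Suc j) * resolvent = resolvent_tail (Suc j)\<close>. It equals
  \<open>sq n\<close> for each of the n values of j.\<close>

lemma newton_resolvent_coeff: "of_nat n * sq n = (\<Sum>m\<le>n. power_sum m * sq (n - m))"
proof -
  have *: "(\<Sum>i\<le>m. omega i k * sq (m - i)) = sq (k + m - 1)" if "m > 0" for m k
  proof -
    from \<open>m > 0\<close> obtain m' where m: "m = Suc m'"
      by (auto simp: gr0_conv_Suc)
    have "(\<Sum>i\<le>m. omega i k * sq (m - i)) = fps_nth (omega_fps k * resolvent) m"
      unfolding fps_mult_nth[of "omega_fps k" resolvent] by (simp only: omega_def resolvent_nth atLeast0AtMost)
    also have "omega_fps k * resolvent = resolvent_tail k"
      using resolvent_mult_omega[of k] by (subst mult.commute)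
    also have "fps_nth (resolvent_tail k) m = sq (k + m - 1)"
      by (simp add: m resolvent_tail_def)
    finally show ?thesis .
  qed
  have "(\<Sum>m\<le>n. power_sum m * sq (n - m)) = (\<Sum>m\<le>n. \<Sum>j<m. omega (m - j) (Suc j) * sq (n - m))"
    by (simp add: power_sum_def sum_distrib_right)
  also have "\<dots> = (\<Sum>j<n. \<Sum>m = Suc j..n. omega (m - j) (Suc j) * sq (n - m))"
    by (rule sum.nested_swap')
  also have "\<dots> = (\<Sum>j<n. sq n)"
  proof (rule sum.cong[OF refl])
    fix j assume "j \<in> {..<n}"
    then have "(\<Sum>m = Suc j..n. omega (m - j) (Suc j) * sq (n - m)) =
        (\<Sum>i\<in>{1..n - j}. omega i (Suc j) * sq (n - j - i))"
      by (intro sum.reindex_bij_witness[of _ "\<lambda>i. i + j" "\<lambda>m. m - j"]) auto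
    also have "\<dots> = (\<Sum>i\<le>n - j. omega i (Suc j) * sq (n - j - i))"
      by (rule sum.mono_neutral_left) (auto simp: Suc_le_eq)
    also have "\<dots> = sq n"
    proof -
      have "0 < n - j" "Suc j + (n - j) - 1 = n"
        using \<open>j \<in> {..<n}\<close> by auto
      then show ?thesis
        using *[of "n - j" "Suc j"] by (simp only:)
    qed
    finally show "(\<Sum>m = Suc j..n. omega (m - j) (Suc j) * sq (n - m)) = sq n" .
  qed
  finally show ?thesis
    by (simp only: sum_constant card_lessThan)
qed

section \<open>Determinants\<close>

abbreviation perms :: "nat \<Rightarrow> (nat \<Rightarrow> nat) set" where
  "perms k \<equiv> {p. p permutes {..<k}}"

lemma detA_cong:
  assumes "\<And>a b. a < k \<Longrightarrow> b < k \<Longrightarrow> M a b = N a b"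
  shows "detA k M = detA k N"
  unfolding detA_def
  by (intro sum.cong refl arg_cong2[of _ _ _ _ "(*)"] prod.cong)
     (use assms permutes_in_image in fastforce)

lemma detA_permute_rows:
  assumes "p permutes {..<k}"
  shows "detA k (\<lambda>a b. M (p a) b) = of_int (sign p) * detA k M"
proof -
  have "(\<Prod>a<k. M (p a) ((q \<circ> p) a)) = (\<Prod>a<k. M a (q a))" for q
    using prod.permute[OF assms, of "\<lambda>a. M a (q a)"] by (simp add: comp_def)
  moreover have "sign (q \<circ> p) = sign p * sign q" if "q \<in> perms k" for q
  proof -
    have "permutation q" "permutation p"
      using that assms by (auto simp: permutation_permutes)
    then show ?thesis
      by (simp add: sign_compose mult.commute)
  qed
  ultimately show ?thesis
    unfolding detA_def
    by (subst sum_permutations_compose_right[OF assms])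
       (simp add: sum_distrib_left mult.assoc)
qed

lemma detA_transpose: "detA k (\<lambda>a b. M b a) = detA k M"
proof -
  have "detA k (\<lambda>a b. M b a) = (\<Sum>p\<in>perms k. of_int (sign (inv p)) * (\<Prod>a<k. M (inv p a) a))"
    unfolding detA_def by (subst sum_permutations_inverse) simp
  also have "\<dots> = detA k M"
    unfolding detA_def
  proof (intro sum.cong refl)
    fix p assume "p \<in> perms k"
    then have p: "p permutes {..<k}" by simp
    have "(\<Prod>a<k. M (inv p a) a) = (\<Prod>a<k. M a (p a))"
      using prod.permute[OF p, of "\<lambda>a. M (inv p a) a"] permutes_inverses(2)[OF p] by (simp add: comp_def)
    moreover have "sign (inv p) = sign p"
      using p by (meson finite_lessThan permutation_permutes sign_inverse)
    ultimately show "of_int (sign (inv p)) * (\<Prod>a<k. M (inv p a) a) = of_int (sign p) * (\<Prod>a<k. M a (p a))"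
      by simp
  qed
  finally show ?thesis .
qed

lemma detA_permute_cols:
  assumes "p permutes {..<k}"
  shows "detA k (\<lambda>a b. M a (p b)) = of_int (sign p) * detA k M"
  using detA_permute_rows[OF assms, of "\<lambda>a b. M b a"] detA_transpose[of k "\<lambda>a b. M a (p b)"]
    detA_transpose[of k M] by simp

lemma kdv_eq_neg_self:
  fixes x :: kdv_ring
  assumes "x = - x"
  shows "x = 0"
proof -
  have "2 * x = x + - x"
    using assms by (metis mult_2)
  then show ?thesis
    by simp
qed

lemma detA_identical_rows:
  assumes "i < k" "j < k" "i \<noteq> j" "\<And>b. b < k \<Longrightarrow> M i b = M j b"
  shows "detA k M = 0"
proof -
  have p: "transpose i j permutes {..<k}"
    using assms by (intro permutes_swap_id) auto
  have "detA k M = detA k (\<lambda>a b. M (transpose i j a) b)"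
    by (rule detA_cong) (auto simp: transpose_def assms)
  also have "\<dots> = - detA k M"
    using assms(3) by (simp add: detA_permute_rows[OF p] sign_swap_id)
  finally show ?thesis
    by (rule kdv_eq_neg_self)
qed

lemma detA_identical_cols:
  assumes "i < k" "j < k" "i \<noteq> j" "\<And>a. a < k \<Longrightarrow> M a i = M a j"
  shows "detA k M = 0"
  using detA_identical_rows[of i k j "\<lambda>a b. M b a"] assms detA_transpose[of k M] by simp

text \<open>A permutation \<open>p\<close> meets column b in row \<open>inv p b\<close>. Isolating
  that factor makes the linearity in the column visible.\<close>

lemma detA_replace_col:
  assumes "b < k"
  shows "detA k (\<lambda>a. (M a)(b := x a)) = (\<Sum>p\<in>perms k. of_int (sign p) *
    (x (inv p b) * (\<Prod>a\<in>{..<k} - {inv p b}. M a (p a))))"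
  unfolding detA_def
proof (intro sum.cong refl arg_cong2[of _ _ _ _ "(*)"])
  fix p assume "p \<in> perms k"
  then have p: "p permutes {..<k}" by simp
  let ?c = "inv p b"
  have c: "p ?c = b" "?c < k"
    using permutes_inverses(1)[OF p] permutes_in_image[OF permutes_inv[OF p]] assms by auto
  have "(\<Prod>a<k. ((M a)(b := x a)) (p a)) =
      ((M ?c)(b := x ?c)) (p ?c) * (\<Prod>a\<in>{..<k} - {?c}. ((M a)(b := x a)) (p a))"
    using c by (intro prod.remove) auto
  also have "(\<Prod>a\<in>{..<k} - {?c}. ((M a)(b := x a)) (p a)) = (\<Prod>a\<in>{..<k} - {?c}. M a (p a))"
    by (intro prod.cong refl) (use permutes_inverses(2)[OF p] in auto)
  finally show "(\<Prod>a<k. ((M a)(b := x a)) (p a)) = x ?c * (\<Prod>a\<in>{..<k} - {?c}. M a (p a))"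
    using c by simp
qed

lemma detA_replace_col_add:
  assumes "b < k"
  shows "detA k (\<lambda>a. (M a)(b := x a + y a)) =
    detA k (\<lambda>a. (M a)(b := x a)) + detA k (\<lambda>a. (M a)(b := y a))"
  unfolding detA_replace_col[OF assms] by (simp add: algebra_simps sum.distrib)

lemma detA_replace_col_diff:
  assumes "b < k"
  shows "detA k (\<lambda>a. (M a)(b := x a - y a)) =
    detA k (\<lambda>a. (M a)(b := x a)) - detA k (\<lambda>a. (M a)(b := y a))"
  unfolding detA_replace_col[OF assms] by (simp add: algebra_simps sum_subtractf)

lemma detA_replace_col_sum:
  assumes "b < k"
  shows "detA k (\<lambda>a. (M a)(b := \<Sum>i\<in>I. c i * x i a)) =
    (\<Sum>i\<in>I. c i * detA k (\<lambda>a. (M a)(b := x i a)))"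
  unfolding detA_replace_col[OF assms]
  by (subst sum_distrib_left, subst sum.swap)
     (simp add: sum_distrib_left sum_distrib_right mult_ac)

lemma detA_scale_cols: "detA k (\<lambda>a b. c b * M a b) = (\<Prod>b<k. c b) * detA k M"
proof -
  have "(\<Prod>a<k. c (p a)) = (\<Prod>b<k. c b)" if "p \<in> perms k" for p
    using that prod.permute[of p "{..<k}" c] by (simp add: comp_def)
  then show ?thesis
    unfolding detA_def prod.distrib sum_distrib_left
    by (intro sum.cong refl) (simp add: mult_ac)
qed

text \<open>Expansion along the last row, from the decomposition of permutations as
  \<open>transpose k b \<circ> q\<close>. The minors are written with column b overwritten by the
  last column, so that they stay indexed by \<open>{..<k}\<close>; the transposition accounts for
  the minus sign.\<close>

lemma detA_Suc:
  "detA (Suc k) M = M k k * detA k M - (\<Sum>b<k. M k b * detA k (\<lambda>a. (M a)(b := M a k)))"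
proof -
  have q: "q k = k" "q permutes {..<k}" "permutation q" if "q \<in> perms k" for q
    using that permutes_not_in[of q "{..<k}" k] by (auto simp: permutation_permutes)
  have "detA (Suc k) M = (\<Sum>b\<in>insert k {..<k}. \<Sum>q\<in>perms k. of_int (sign (transpose k b \<circ> q)) *
      (\<Prod>a<Suc k. M a ((transpose k b \<circ> q) a)))"
    unfolding detA_def lessThan_Suc by (subst sum_over_permutations_insert) auto
  also have "\<dots> = (\<Sum>q\<in>perms k. of_int (sign q) * (\<Prod>a<Suc k. M a (q a))) +
      (\<Sum>b<k. \<Sum>q\<in>perms k. of_int (sign (transpose k b \<circ> q)) *
        (\<Prod>a<Suc k. M a ((transpose k b \<circ> q) a)))"
    by (subst sum.insert) (simp_all only: finite_lessThan lessThan_iff less_irrefl transpose_eq_id_iff[THEN iffD2] id_comp simp_thms)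
  also have "(\<Sum>q\<in>perms k. of_int (sign q) * (\<Prod>a<Suc k. M a (q a))) = M k k * detA k M"
    unfolding detA_def sum_distrib_left
  proof (intro sum.cong refl)
    fix p assume "p \<in> perms k"
    from q(1)[OF this]
    show "of_int (sign p) * (\<Prod>a<Suc k. M a (p a)) = M k k * (of_int (sign p) * (\<Prod>a<k. M a (p a)))"
      by (simp add: mult_ac)
  qed
  also have "(\<Sum>b<k. \<Sum>q\<in>perms k. of_int (sign (transpose k b \<circ> q)) *
        (\<Prod>a<Suc k. M a ((transpose k b \<circ> q) a))) =
      (\<Sum>b<k. - (M k b * detA k (\<lambda>a. (M a)(b := M a k))))"
  proof (rule sum.cong[OF refl])
    fix b assume b: "b \<in> {..<k}"
    have "of_int (sign (transpose k b \<circ> q)) * (\<Prod>a<Suc k. M a ((transpose k b \<circ> q) a)) =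
        - (M k b * (of_int (sign q) * (\<Prod>a<k. ((M a)(b := M a k)) (q a))))" if "q \<in> perms k" for q
    proof -
      have "(\<Prod>a<k. M a ((transpose k b \<circ> q) a)) = (\<Prod>a<k. ((M a)(b := M a k)) (q a))"
      proof (intro prod.cong refl)
        fix a assume "a \<in> {..<k}"
        then have "q a \<noteq> k"
          using permutes_in_image[OF q(2)[OF that], of a] by auto
        then show "M a ((transpose k b \<circ> q) a) = ((M a)(b := M a k)) (q a)"
          by (auto simp: transpose_def)
      qed
      moreover have "sign (transpose k b \<circ> q) = - sign q"
        using b q[OF that] by (simp add: sign_compose permutation_swap_id sign_swap_id)
      ultimately show ?thesis
        using q[OF that] by simp
    qed
    then show "(\<Sum>q\<in>perms k. of_int (sign (transpose k b \<circ> q)) *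
        (\<Prod>a<Suc k. M a ((transpose k b \<circ> q) a))) = - (M k b * detA k (\<lambda>a. (M a)(b := M a k)))"
      unfolding detA_def sum_distrib_left sum_negf[symmetric] by (intro sum.cong refl)
  qed
  finally show ?thesis
    by (simp add: sum_negf)
qed

text \<open>For each permutation, both sides sum over the cells of its graph the product in which
  the entry in that cell is taken from \<open>N\<close>. One side lists the cells by rows, the other
  by columns.\<close>

lemma sum_detA_replace_rows:
  "(\<Sum>i<k. detA k (M(i := N i))) = (\<Sum>b<k. detA k (\<lambda>a. (M a)(b := N a b)))"
proof -
  have row: "detA k (M(i := N i)) = (\<Sum>p\<in>perms k. of_int (sign p) *
      (N i (p i) * (\<Prod>a\<in>{..<k} - {i}. M a (p a))))" if "i < k" for i
  proof -
    have "(\<Prod>a<k. (M(i := N i)) a (p a)) = N i (p i) * (\<Prod>a\<in>{..<k} - {i}. M a (p a))" for p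
    proof -
      have "(\<Prod>a<k. (M(i := N i)) a (p a)) =
        (M(i := N i)) i (p i) * (\<Prod>a\<in>{..<k} - {i}. (M(i := N i)) a (p a))"
        using that by (intro prod.remove) auto
      also have "(\<Prod>a\<in>{..<k} - {i}. (M(i := N i)) a (p a)) = (\<Prod>a\<in>{..<k} - {i}. M a (p a))"
        by (intro prod.cong) auto
      finally show ?thesis by simp
    qed
    then show ?thesis
      by (simp add: detA_def)
  qed
  have "(\<Sum>i<k. N i (p i) * (\<Prod>a\<in>{..<k} - {i}. M a (p a))) =
      (\<Sum>b<k. N (inv p b) b * (\<Prod>a\<in>{..<k} - {inv p b}. M a (p a)))" if "p \<in> perms k" for p
  proof -
    have p: "p permutes {..<k}" using that by simp
    show ?thesis
      by (rule sum.reindex_bij_witness[of _ "inv p" p])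
         (use permutes_inverses[OF p] permutes_in_image[OF p] permutes_in_image[OF permutes_inv[OF p]] in auto)
  qed
  then have "(\<Sum>p\<in>perms k. of_int (sign p) * (\<Sum>i<k. N i (p i) * (\<Prod>a\<in>{..<k} - {i}. M a (p a)))) =
     (\<Sum>p\<in>perms k. of_int (sign p) * (\<Sum>b<k. N (inv p b) b * (\<Prod>a\<in>{..<k} - {inv p b}. M a (p a))))"
    by (intro sum.cong refl) simp
  then have "(\<Sum>i<k. \<Sum>p\<in>perms k. of_int (sign p) * (N i (p i) * (\<Prod>a\<in>{..<k} - {i}. M a (p a)))) =
     (\<Sum>b<k. \<Sum>p\<in>perms k. of_int (sign p) * (N (inv p b) b * (\<Prod>a\<in>{..<k} - {inv p b}. M a (p a))))"
    by (simp only: sum_distrib_left sum.swap[of _ "perms k"])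
  moreover have "(\<Sum>i<k. detA k (M(i := N i))) = (\<Sum>i<k. \<Sum>p\<in>perms k. of_int (sign p) *
      (N i (p i) * (\<Prod>a\<in>{..<k} - {i}. M a (p a))))"
    by (intro sum.cong refl row) simp
  moreover have "(\<Sum>b<k. detA k (\<lambda>a. (M a)(b := N a b))) = (\<Sum>b<k. \<Sum>p\<in>perms k. of_int (sign p) *
      (N (inv p b) b * (\<Prod>a\<in>{..<k} - {inv p b}. M a (p a))))"
    by (intro sum.cong refl detA_replace_col) simp
  ultimately show ?thesis
    by (simp only:)
qed

text \<open>If \<open>\<omega>\<^sub>1, \<dots>, \<omega>\<^sub>k\<close> are closed one-forms in \<open>k\<close> variables, then
  \<open>dr \<and> \<omega>\<^sub>2 \<and> \<dots> \<and> \<omega>\<^sub>k = d (r \<omega>\<^sub>2 \<and> \<dots> \<and> \<omega>\<^sub>k)\<close> is exact.\<close>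
lemma detA_exact_col:
  assumes der: "\<And>a. derivation (d a)" and b: "b < k"
    and closed: "\<And>a a' c. a < k \<Longrightarrow> a' < k \<Longrightarrow> c < k \<Longrightarrow> d a (M a' c) = d a' (M a c)"
  shows "detA k (\<lambda>a. (M a)(b := d a r)) =
    (\<Sum>a<k. d a (r * detA k (\<lambda>a'. (M a')(b := if a' = a then 1 else 0))))"
proof -
  interpret derivation "d a" for a by (rule der)
  let ?e = "\<lambda>p. inv p b"
  let ?P = "\<lambda>p. \<Prod>a\<in>{..<k} - {?e p}. M a (p a)"
  \<comment> \<open>The cofactor of the entry in row a and column b. It remains to show that the
    cofactors have zero divergence.\<close>
  define cof where "cof a = detA k (\<lambda>a'. (M a')(b := if a' = a then 1 else 0))" for a
  have cof: "cof a = (\<Sum>p\<in>perms k. of_int (sign p) * ((if ?e p = a then 1 else 0) * ?P p))" for a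
    unfolding cof_def by (rule detA_replace_col[OF b])
  have e: "?e p < k" "p (?e p) = b" "p permutes {..<k}" if "p \<in> perms k" for p
    using that permutes_inverses(1)[of p] permutes_in_image[OF permutes_inv, of p] b by auto
  have dcof: "d a (cof a) = (\<Sum>p\<in>perms k. if ?e p = a then of_int (sign p) * d a (?P p) else 0)" for a
  proof -
    have "d a (of_int i) = 0" for i
      by (cases i rule: int_cases2) (simp_all add: minus)
    then show ?thesis
      unfolding cof sum mult by (intro sum.cong refl) auto
  qed
  have "(\<Sum>a<k. d a (cof a)) = (\<Sum>p\<in>perms k. of_int (sign p) * d (?e p) (?P p))"
    unfolding dcof
  proof (subst sum.swap, rule sum.cong[OF refl])
    fix p assume "p \<in> perms k"
    from e(1)[OF this]
    show "(\<Sum>a<k. if ?e p = a then of_int (sign p) * d a (?P p) else 0) = of_int (sign p) * d (?e p) (?P p)"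
      by (simp add: sum.delta')
  qed
  also have "\<dots> = (\<Sum>p\<in>perms k. \<Sum>c\<in>{..<k} - {?e p}. of_int (sign p) *
      (d (?e p) (M c (p c)) * (\<Prod>a\<in>{..<k} - {?e p} - {c}. M a (p a))))"
    by (simp add: prod sum_distrib_left)
  also have "\<dots> = (\<Sum>(p, c)\<in>(SIGMA p:perms k. {..<k} - {?e p}). of_int (sign p) *
      (d (?e p) (M c (p c)) * (\<Prod>a\<in>{..<k} - {?e p} - {c}. M a (p a))))" (is "_ = sum ?f ?S")
    by (rule sum.Sigma) (simp_all add: finite_permutations)
  also have "\<dots> = 0"
  proof -
    \<comment> \<open>Sign-reversing involution: it exchanges the roles of row \<open>?e p\<close>,
      whose flow acts, and row c, on whose entry it acts. Closedness makes the differentiated entry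
      invariant, so the sum equals its own negative.\<close>
    let ?\<phi> = "\<lambda>(p, c). (p \<circ> transpose (?e p) c, ?e p)"
    have *: "?e (p \<circ> transpose (?e p) c) = c" "p \<circ> transpose (?e p) c \<in> perms k"
      if "p \<in> perms k" "c < k" for p c
    proof -
      have "bij p"
        using e(3)[OF that(1)] by (rule permutes_bij)
      then show "?e (p \<circ> transpose (?e p) c) = c"
        using e(2)[OF that(1)] by (intro inv_f_eq) (auto intro!: bij_is_inj bij_comp)
      show "p \<circ> transpose (?e p) c \<in> perms k"
        using e[OF that(1)] that(2) by (auto intro!: permutes_compose permutes_swap_id)
    qed
    have phi: "?\<phi> (?\<phi> x) = x \<and> ?\<phi> x \<in> ?S" if "x \<in> ?S" for x
    proof -
      obtain p c where x: "x = (p, c)" "p \<in> perms k" "c < k" "c \<noteq> ?e p"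
        using \<open>x \<in> ?S\<close> by auto
      have "p \<circ> transpose (?e p) c \<circ> transpose c (?e p) = p"
        by (simp add: comp_assoc transpose_commute[of c])
      then show ?thesis
        using *[OF x(2,3)] e(1)[OF x(2)] x by simp
    qed
    have "sum ?f ?S = sum (\<lambda>x. - ?f x) ?S"
    proof (rule sum.reindex_bij_witness[of _ ?\<phi> ?\<phi>], goal_cases)
      case (1 x)
      from phi[OF this] show ?case by (rule conjunct1)
    next
      case (2 x)
      from phi[OF this] show ?case by (rule conjunct2)
    next
      case (3 x)
      from phi[OF this] show ?case by (rule conjunct1)
    next
      case (4 x)
      from phi[OF this] show ?case by (rule conjunct2)
    next
      case (5 x)
      then obtain p c where x: "x = (p, c)" "p \<in> perms k" "c < k" "c \<noteq> ?e p"
        by auto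
      let ?q = "p \<circ> transpose (?e p) c"
      have q: "?e ?q = c" "?q (?e p) = p c"
        using *[OF x(2,3)] by simp_all
      have "permutation p"
        using e(3)[OF x(2)] by (auto simp: permutation_permutes)
      then have "sign ?q = - sign p"
        using x(4) by (simp add: sign_compose permutation_swap_id sign_swap_id)
      moreover have "(\<Prod>a\<in>{..<k} - {c} - {?e p}. M a (?q a)) = (\<Prod>a\<in>{..<k} - {?e p} - {c}. M a (p a))"
        by (rule prod.cong) auto
      moreover have "d c (M (?e p) (p c)) = d (?e p) (M c (p c))"
        using x(3) e(1)[OF x(2)] permutes_in_image[OF e(3)[OF x(2)], of c] by (intro closed) simp_all
      ultimately show ?case
        using q unfolding x(1) by simp
    qed
    then show ?thesis
      unfolding sum_negf by (rule kdv_eq_neg_self)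
  qed
  finally have 0: "(\<Sum>a<k. d a (cof a)) = 0" .
  have "(\<Sum>a<k. d a r * cof a) = (\<Sum>p\<in>perms k. of_int (sign p) * (d (?e p) r * ?P p))"
    unfolding cof sum_distrib_left
  proof (subst sum.swap, rule sum.cong[OF refl])
    fix p assume "p \<in> perms k"
    note p = e(1)[OF this]
    have "d a r * (of_int (sign p) * ((if ?e p = a then 1 else 0) * ?P p)) =
        (if ?e p = a then of_int (sign p) * (d a r * ?P p) else 0)" for a
      by (simp add: mult_ac)
    then show "(\<Sum>a<k. d a r * (of_int (sign p) * ((if ?e p = a then 1 else 0) * ?P p))) =
        of_int (sign p) * (d (?e p) r * ?P p)"
      using p by (simp only: sum.delta') (simp add: sum.delta')
  qed
  also have "\<dots> = detA k (\<lambda>a. (M a)(b := d a r))"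
    by (rule detA_replace_col[OF b, symmetric])
  finally have "detA k (\<lambda>a. (M a)(b := d a r)) = (\<Sum>a<k. d a r * cof a) + r * (\<Sum>a<k. d a (cof a))"
    by (simp add: 0)
  also have "\<dots> = (\<Sum>a<k. d a (r * cof a))"
    by (simp add: mult sum.distrib sum_distrib_left)
  finally show ?thesis
    by (simp add: cof_def)
qed

section \<open>Minors of the closed forms\<close>

abbreviation omega_minor :: "nat \<Rightarrow> (nat \<Rightarrow> nat) \<Rightarrow> (nat \<Rightarrow> nat) \<Rightarrow> kdv_ring" where
  "omega_minor k n m \<equiv> detA k (\<lambda>a b. omega (n b) (m a))"

definition omega_minors :: "kdv_ring set" where
  "omega_minors = {omega_minor k n m |k n m. (\<forall>a<k. m a > 0) \<and> (\<forall>b<k. n b > 0)}"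

text \<open>The Murnaghan--Nakayama rule in Frobenius coordinates.\<close>
lemma power_sum_mult_omega_minor:
  assumes n: "\<And>b. b < k \<Longrightarrow> n b > 0"
  shows "power_sum l * omega_minor k n m =
    (\<Sum>j<l. omega_minor (Suc k) (n(k := l - j)) (m(k := Suc j)))
    + (\<Sum>a<k. omega_minor k n (m(a := m a + l))) - (\<Sum>b<k. omega_minor k (n(b := n b + l)) m)"
proof -
  let ?M = "\<lambda>a b. omega (n b) (m a)"
  let ?R = "\<lambda>j b. detA k (\<lambda>a. (?M a)(b := omega (l - j) (m a)))"
  have border: "omega_minor (Suc k) (n(k := l - j)) (m(k := Suc j)) =
      omega (l - j) (Suc j) * detA k ?M - (\<Sum>b<k. omega (n b) (Suc j) * ?R j b)" for j
  proof -
    let ?M' = "\<lambda>a b. omega ((n(k := l - j)) b) ((m(k := Suc j)) a)"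
    have 1: "detA k ?M' = detA k ?M"
      by (rule detA_cong) simp
    have 2: "detA k (\<lambda>a. (?M' a)(b := ?M' a k)) = ?R j b" for b
      by (rule detA_cong) simp
    have 3: "?M' k b = omega (n b) (Suc j)" if "b < k" for b
      using that by simp
    have "(\<Sum>b<k. ?M' k b * ?R j b) = (\<Sum>b<k. omega (n b) (Suc j) * ?R j b)"
      by (intro sum.cong refl arg_cong2[of _ _ _ _ "(*)"] 3) simp
    moreover have "?M' k k = omega (l - j) (Suc j)"
      by simp
    ultimately show ?thesis
      unfolding detA_Suc[of k ?M'] 1 2 by (simp only:)
  qed
  \<comment> \<open>\<open>omega_add\<close> trades a shift of the column label for shifts of the
    row labels; the corrections contain the same determinants \<open>?R j b\<close> as
    \<open>border\<close>.\<close>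
  have col: "omega_minor k (n(b := n b + l)) m =
      detA k (\<lambda>a. (?M a)(b := omega (n b) (m a + l))) - (\<Sum>j<l. omega (n b) (Suc j) * ?R j b)"
    if "b < k" for b
  proof -
    have "omega_minor k (n(b := n b + l)) m = detA k (\<lambda>a. (?M a)(b := omega (n b + l) (m a)))"
      by (rule detA_cong) simp
    also have "\<dots> = detA k (\<lambda>a. (?M a)(b := omega (n b) (m a + l)
        - (\<Sum>j<l. omega (n b) (Suc j) * omega (l - j) (m a))))"
      by (simp only: omega_add[OF n[OF that]])
    finally show ?thesis
      by (simp only: detA_replace_col_diff[OF that] detA_replace_col_sum[OF that])
  qed
  have row: "(\<Sum>a<k. omega_minor k n (m(a := m a + l))) =
      (\<Sum>b<k. detA k (\<lambda>a. (?M a)(b := omega (n b) (m a + l))))"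
  proof -
    have "omega_minor k n (m(a := m a + l)) = detA k (?M(a := \<lambda>b. omega (n b) (m a + l)))" for a
      by (rule detA_cong) simp
    then show ?thesis
      using sum_detA_replace_rows[of k ?M "\<lambda>a b. omega (n b) (m a + l)"] by (simp only:)
  qed
  have cols: "(\<Sum>b<k. omega_minor k (n(b := n b + l)) m) =
      (\<Sum>b<k. detA k (\<lambda>a. (?M a)(b := omega (n b) (m a + l)))) -
      (\<Sum>b<k. \<Sum>j<l. omega (n b) (Suc j) * ?R j b)"
    unfolding sum_subtractf[symmetric] by (intro sum.cong refl col) simp
  have borders: "(\<Sum>j<l. omega_minor (Suc k) (n(k := l - j)) (m(k := Suc j))) =
      power_sum l * detA k ?M - (\<Sum>b<k. \<Sum>j<l. omega (n b) (Suc j) * ?R j b)"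
    unfolding border sum_subtractf power_sum_def sum_distrib_right by (subst (2) sum.swap) (rule refl)
  \<comment> \<open>Here p is the product, x the double sum of corrections and y the sum with
    shifted rows. The bordered minors give p - x, and the shifted columns give y - x.\<close>
  have "p = (p - x) + y - (y - x)" for p x y :: kdv_ring
    by simp
  then show ?thesis
    unfolding row cols borders .
qed

lemma power_sum_mult_span:
  assumes "w \<in> kdv.span omega_minors"
  shows "power_sum l * w \<in> kdv.span omega_minors"
  using assms
proof (induction rule: kdv.span_induct_alt)
  case base
  then show ?case
    by (simp add: kdv.span_zero)
next
  case (step c x y)
  then obtain k n m where x: "x = omega_minor k n m" and pos: "\<forall>a<k. m a > 0" "\<forall>b<k. n b > 0"
    unfolding omega_minors_def by blast
  have base: "omega_minor k' n' m' \<in> kdv.span omega_minors"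
    if "\<forall>a<k'. m' a > 0" "\<forall>b<k'. n' b > 0" for k' n' m'
    by (rule kdv.span_base) (use that in \<open>unfold omega_minors_def, blast\<close>)
  have "power_sum l * x \<in> kdv.span omega_minors"
    unfolding x using pos
    by (subst power_sum_mult_omega_minor) (auto intro!: kdv.span_add kdv.span_diff kdv.span_sum base)
  then have "cst c * (power_sum l * x) + power_sum l * y \<in> kdv.span omega_minors"
    using step by (intro kdv.span_add kdv.span_scale)
  then show ?case
    by (simp only: distrib_left mult.left_commute)
qed

text \<open>Newton's identities express \<open>of_nat n * sq n\<close> through products of power
  sums with lower coefficients, as \<open>power_sum 0\<close> is zero. Strong induction and division
  by n do the rest.\<close>

lemma resolvent_coeff_mult_span:
  assumes "w \<in> kdv.span omega_minors"
  shows "sq n * w \<in> kdv.span omega_minors"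
proof (induction n rule: less_induct)
  case (less n)
  show ?case
  proof (cases "n = 0")
    case False
    have "power_sum m * (sq (n - m) * w) \<in> kdv.span omega_minors" if "m \<le> n" for m
    proof (cases "m = 0")
      case True
      then show ?thesis
        by (simp add: power_sum_def kdv.span_zero)
    next
      case False
      with that less[of "n - m"] show ?thesis
        by (intro power_sum_mult_span) auto
    qed
    then have "(\<Sum>m\<le>n. power_sum m * (sq (n - m) * w)) \<in> kdv.span omega_minors"
      by (intro kdv.span_sum) simp
    then have "of_nat n * (sq n * w) \<in> kdv.span omega_minors"
      by (simp only: mult.assoc[symmetric] newton_resolvent_coeff sum_distrib_right)
    then have "cst (1 / of_nat n) * (cst (of_nat n) * (sq n * w)) \<in> kdv.span omega_minors"
      unfolding cst_of_nat by (rule kdv.span_scale)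
    moreover have "cst (1 / of_nat n) * cst (of_nat n) = 1"
      using False by (simp add: cst_mult[symmetric])
    ultimately show ?thesis
      by (simp add: mult.assoc[symmetric])
  qed (use assms in simp)
qed

lemma S_monomial_eq: "S_monomial s = (\<Prod>i\<in>keys s. sq (Suc i) ^ lookup s i)"
  unfolding S_monomial_def using S_eq[of "Suc _"] by simp

text \<open>The span contains 1, the minor of size zero, and is stable under multiplication by each
  \<open>sq n\<close>.\<close>

lemma S_monomial_in_span_omega_minors: "S_monomial s \<in> kdv.span omega_minors"
proof -
  have "1 \<in> omega_minors"
    unfolding omega_minors_def mem_Collect_eq
    by (rule exI[of _ 0], rule exI[of _ "\<lambda>_. 0"], rule exI[of _ "\<lambda>_. 0"]) (simp add: detA_def)
  then have 1: "1 \<in> kdv.span omega_minors"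
    by (rule kdv.span_base)
  have pow: "sq i ^ e * w \<in> kdv.span omega_minors" if "w \<in> kdv.span omega_minors" for i e w
    using that by (induction e) (simp_all add: resolvent_coeff_mult_span mult.assoc)
  have "(\<Prod>i\<in>I. sq (Suc i) ^ f i) \<in> kdv.span omega_minors" if "finite I" for I and f :: "nat \<Rightarrow> nat"
    using that by (induction I) (simp_all add: 1 pow)
  then show ?thesis
    unfolding S_monomial_eq by simp
qed

section \<open>The algebra generated by the coefficients of the resolvent\<close>

definition S_algebra :: "kdv_ring set" where
  "S_algebra = kdv.span (range S_monomial)"

lemma S_monomial_0 [simp]: "S_monomial 0 = 1"
  by (simp add: S_monomial_def)

lemma S_monomial_superset:
  assumes "finite I" "keys s \<subseteq> I"
  shows "S_monomial s = (\<Prod>i\<in>I. sq (Suc i) ^ lookup s i)"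
  unfolding S_monomial_eq using assms by (intro prod.mono_neutral_left) (auto simp: in_keys_iff)

lemma S_monomial_add: "S_monomial (s + t) = S_monomial s * S_monomial t"
proof -
  let ?I = "keys s \<union> keys t"
  have "S_monomial (s + t) = (\<Prod>i\<in>?I. sq (Suc i) ^ lookup (s + t) i)"
    by (rule S_monomial_superset) (auto simp: Poly_Mapping.keys_add)
  then show ?thesis
    by (simp add: S_monomial_superset[of ?I] lookup_add power_add prod.distrib)
qed

lemma S_algebra_1: "1 \<in> S_algebra"
  unfolding S_algebra_def by (rule kdv.span_base) (metis S_monomial_0 rangeI)

lemma S_algebra_diff: "p \<in> S_algebra \<Longrightarrow> q \<in> S_algebra \<Longrightarrow> p - q \<in> S_algebra"
  and S_algebra_scale: "p \<in> S_algebra \<Longrightarrow> cst c * p \<in> S_algebra"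
  and S_algebra_0: "0 \<in> S_algebra"
  and S_algebra_sum: "(\<And>i. i \<in> I \<Longrightarrow> f i \<in> S_algebra) \<Longrightarrow> (\<Sum>i\<in>I. f i) \<in> S_algebra"
  unfolding S_algebra_def
  by (simp_all add: kdv.span_diff kdv.span_scale kdv.span_zero kdv.span_sum)

lemma S_algebra_mult:
  assumes "p \<in> S_algebra" "q \<in> S_algebra"
  shows "p * q \<in> S_algebra"
proof -
  have *: "S_monomial s * q \<in> S_algebra" for s
    using assms(2) unfolding S_algebra_def
  proof (induction rule: kdv.span_induct_alt)
    case base
    then show ?case
      by (simp add: kdv.span_zero)
  next
    case (step c x y)
    then obtain t where "x = S_monomial t"
      by blast
    then have "S_monomial s * x = S_monomial (s + t)"
      by (simp add: S_monomial_add)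
    then have "S_monomial s * x \<in> kdv.span (range S_monomial)"
      by (simp add: kdv.span_base)
    then have "cst c * (S_monomial s * x) + S_monomial s * y \<in> kdv.span (range S_monomial)"
      using step by (intro kdv.span_add kdv.span_scale)
    then show ?case
      by (simp only: distrib_left mult.left_commute)
  qed
  show ?thesis
    using assms(1) unfolding S_algebra_def
  proof (induction rule: kdv.span_induct_alt)
    case base
    then show ?case
      by (simp add: kdv.span_zero)
  next
    case (step c x y)
    then have "x * q \<in> kdv.span (range S_monomial)"
      using * unfolding S_algebra_def by blast
    then have "cst c * (x * q) + y * q \<in> kdv.span (range S_monomial)"
      using step by (intro kdv.span_add kdv.span_scale)
    then show ?case
      by (simp only: distrib_right mult.assoc)
  qed
qed

lemma resolvent_coeff_in_S_algebra: "sq n \<in> S_algebra"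
proof (cases n)
  case 0
  then show ?thesis
    by (simp add: S_algebra_1)
next
  case (Suc m)
  then have "sq n = S_monomial (single m 1)"
    by (simp add: S_monomial_eq)
  then show ?thesis
    unfolding S_algebra_def by (simp add: kdv.span_base)
qed

text \<open>\<open>omega_Suc\<close> reduces to first index 1, where \<open>omega_1\<close> gives
  the generators themselves.\<close>

lemma omega_in_S_algebra: "omega n k \<in> S_algebra"
proof (induction n arbitrary: k)
  case (Suc n)
  show ?case
  proof (cases "n = 0")
    case True
    then show ?thesis
      using omega_1[of k] by (simp add: resolvent_coeff_in_S_algebra)
  next
    case False
    then show ?thesis
      using Suc omega_Suc[of n k] omega_1[of k]
      by (simp add: S_algebra_diff S_algebra_mult resolvent_coeff_in_S_algebra)
  qed
qed (simp add: S_algebra_0)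

lemma detA_in_S_algebra:
  assumes "\<And>a b. M a b \<in> S_algebra"
  shows "detA k M \<in> S_algebra"
proof -
  have "(\<Prod>a\<in>I. M a (p a)) \<in> S_algebra" if "finite I" for I p
    using that by (induction I) (simp_all add: S_algebra_1 S_algebra_mult assms)
  then show ?thesis
    unfolding detA_def by (intro S_algebra_sum) (simp add: cst_of_int[symmetric] S_algebra_scale)
qed

section \<open>Comparison modulo total derivatives\<close>

definition flow_images :: "kdv_ring set" where
  "flow_images = (\<Union>i. range (flow (Suc i)))"

text \<open>The columns are exchanged one at a time. By \<open>zeta_eq\<close> the two versions of a
  column differ by an exact form, and since all other columns are closed,
  \<open>detA_exact_col\<close> writes the difference of determinants as a sum of flow
  images.\<close>

lemma zeta_minor_minus_omega_minor:
  assumes m: "\<And>a. a < k \<Longrightarrow> m a > 0" and n: "\<And>b. b < k \<Longrightarrow> n b > 0"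
  shows "detA k (\<lambda>a b. zeta (2 * m a - 1) (2 * n b - 1)) -
    (\<Prod>b<k. of_nat (2 * n b - 1)) * omega_minor k n m \<in> kdv.span flow_images"
proof -
  let ?Z = "\<lambda>a b. zeta (2 * m a - 1) (2 * n b - 1)"
  let ?O = "\<lambda>a b. of_nat (2 * n b - 1) * omega (n b) (m a)"
  define M where "M j a b = (if b < j then ?Z a b else ?O a b)" for j a b
  have Z: "?Z a b = flow (m a) (potential (n b)) + ?O a b" if "a < k" "b < k" for a b
    using zeta_eq[OF n[OF that(2)] m[OF that(1)]] .
  have of_nat: "flow i (of_nat l * p) = of_nat l * flow i p" for i l p
    by (simp add: flow.mult)
  have closedO: "flow (m a) (?O a' b) = flow (m a') (?O a b)" for a a' b
    unfolding of_nat omega_closed[of "m a"] ..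
  \<comment> \<open>The columns already replaced are closed too: their exact part is closed because
    the flows commute.\<close>
  have closed: "flow (m a) (M j a' c) = flow (m a') (M j a c)" if "a < k" "a' < k" "c < k" for j a a' c
  proof (cases "c < j")
    case True
    then show ?thesis
      using that by (simp only: M_def if_True Z flow.add closedO flow_commute[of "m a"])
  next
    case False
    then show ?thesis
      by (simp only: M_def if_False closedO)
  qed
  have step: "detA k (M (Suc j)) - detA k (M j) \<in> kdv.span flow_images" if "j < k" for j
  proof -
    have "detA k (M (Suc j)) = detA k (\<lambda>a. (M j a)(j := flow (m a) (potential (n j)) + ?O a j))"
      by (rule detA_cong) (use Z in \<open>auto simp: M_def less_Suc_eq\<close>)
    moreover have "detA k (M j) = detA k (\<lambda>a. (M j a)(j := ?O a j))"
      by (rule detA_cong) (auto simp: M_def)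
    ultimately have "detA k (M (Suc j)) - detA k (M j) =
        detA k (\<lambda>a. (M j a)(j := flow (m a) (potential (n j))))"
      using detA_replace_col_add[OF that, of "M j"] by simp
    also have "\<dots> = (\<Sum>a<k. flow (m a) (potential (n j) *
        detA k (\<lambda>a'. (M j a')(j := if a' = a then 1 else 0))))"
      by (rule detA_exact_col[where d = "\<lambda>a. flow (m a)", OF flow.derivation_axioms that closed])
    also have "\<dots> \<in> kdv.span flow_images"
    proof (intro kdv.span_sum kdv.span_base)
      fix a p assume "a \<in> {..<k}"
      \<comment> \<open>Only flows of positive index contribute to
        \<open>flow_images\<close>.\<close>
      then have "m a = Suc (m a - 1)"
        using m by simp
      then show "flow (m a) p \<in> flow_images" for p
        unfolding flow_images_def by (metis UN_I UNIV_I rangeI)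
    qed
    finally show ?thesis .
  qed
  have "detA k (M j) - detA k (M 0) \<in> kdv.span flow_images" if "j \<le> k" for j
    using that
  proof (induction j)
    case (Suc j)
    then have "(detA k (M (Suc j)) - detA k (M j)) + (detA k (M j) - detA k (M 0)) \<in> kdv.span flow_images"
      by (intro kdv.span_add step) auto
    then show ?case
      by simp
  qed (simp add: kdv.span_zero)
  from this[of k] have "detA k (M k) - detA k (M 0) \<in> kdv.span flow_images"
    by simp
  moreover have "detA k (M k) = detA k ?Z"
    by (rule detA_cong) (simp add: M_def)
  moreover have "detA k (M 0) = (\<Prod>b<k. of_nat (2 * n b - 1)) * omega_minor k n m"
    unfolding detA_scale_cols[symmetric] M_def by simp
  ultimately show ?thesis
    by (simp only:)
qed

definition fock_values :: "kdv_ring set" where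
  "fock_values = {ev2_basis_value L J |L J. fock_label L J}"

text \<open>Modulo flow images a Fock value is a multiple of a minor of \<open>omega\<close>, whose
  entries lie in the algebra generated by the S.\<close>

lemma fock_value_in_span: "fock_values \<subseteq> kdv.span (range S_monomial \<union> flow_images)"
proof
  fix x assume "x \<in> fock_values"
  then obtain L J where x: "x = ev2_basis_value L J" and LJ: "fock_label L J"
    unfolding fock_values_def by blast
  let ?k = "card L"
  \<comment> \<open>Recovers m from the odd label 2m - 1, and likewise n below.\<close>
  define m where "m a = Suc (sorted_list_of_set L ! a) div 2" for a
  define n where "n b = Suc (sorted_list_of_set J ! b) div 2" for b
  have k: "card L = card J" and fin: "finite L" "finite J"
    using LJ by (auto simp: fock_label_def)
  have half: "2 * (Suc l div 2) - 1 = l" "Suc l div 2 > 0" if "odd l" for l :: nat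
    using that by (auto elim!: oddE)
  have "sorted_list_of_set L ! a \<in> L" "sorted_list_of_set J ! a \<in> J" if "a < ?k" for a
    using that k fin nth_mem[of a "sorted_list_of_set L"] nth_mem[of a "sorted_list_of_set J"] by simp_all
  then have odd: "odd (sorted_list_of_set L ! a)" "odd (sorted_list_of_set J ! a)" if "a < ?k" for a
    using that LJ unfolding fock_label_def by blast+
  have m: "2 * m a - 1 = sorted_list_of_set L ! a" "m a > 0"
    and n: "2 * n a - 1 = sorted_list_of_set J ! a" "n a > 0" if "a < ?k" for a
    unfolding m_def n_def by (rule half odd that)+
  have "detA ?k (\<lambda>a b. zeta (sorted_list_of_set L ! a) (sorted_list_of_set J ! b)) =
      detA ?k (\<lambda>a b. zeta (2 * m a - 1) (2 * n b - 1))"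
    by (rule detA_cong) (simp only: m n)
  then have x_eq: "x = cst (of_int (sgn_IIc L)) *
     ((detA ?k (\<lambda>a b. zeta (2 * m a - 1) (2 * n b - 1)) -
       (\<Prod>b<?k. of_nat (2 * n b - 1)) * omega_minor ?k n m)
      + cst (\<Prod>b<?k. of_nat (2 * n b - 1)) * omega_minor ?k n m)"
    unfolding x ev2_basis_value_def cst_of_int
    by (simp only: of_nat_prod[symmetric] cst_of_nat diff_add_cancel)
  have a: "detA ?k (\<lambda>a b. zeta (2 * m a - 1) (2 * n b - 1)) -
       (\<Prod>b<?k. of_nat (2 * n b - 1)) * omega_minor ?k n m \<in> kdv.span (range S_monomial \<union> flow_images)"
    using zeta_minor_minus_omega_minor[of ?k m n, OF m(2) n(2)] by (rule subsetD[OF kdv.span_mono[OF Un_upper2]])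
  have b: "omega_minor ?k n m \<in> kdv.span (range S_monomial \<union> flow_images)"
  proof (rule subsetD[OF kdv.span_mono[OF Un_upper1]])
    show "omega_minor ?k n m \<in> kdv.span (range S_monomial)"
      using detA_in_S_algebra[OF omega_in_S_algebra] unfolding S_algebra_def .
  qed
  show "x \<in> kdv.span (range S_monomial \<union> flow_images)"
    unfolding x_eq by (rule kdv.span_scale[OF kdv.span_add[OF a kdv.span_scale[OF b]]])
qed

text \<open>Needed because Fock labels are sets, listed in increasing order, while minors have
  arbitrary index tuples.\<close>

lemma sorting_permutation:
  fixes f :: "nat \<Rightarrow> nat"
  assumes "inj_on f {..<k}"
  shows "\<exists>p. p permutes {..<k} \<and> (\<forall>a<k. f a = sorted_list_of_set (f ` {..<k}) ! p a)"
proof -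
  let ?xs = "map f [0..<k]" and ?ys = "sorted_list_of_set (f ` {..<k})"
  have "mset ?xs = mset ?ys"
    using assms by (subst set_eq_iff_mset_eq_distinct[symmetric])
      (auto simp: distinct_map atLeast0LessThan)
  then obtain p where p: "p permutes {..<length ?ys}" "permute_list p ?ys = ?xs"
    by (rule mset_eq_permutation)
  have len: "length ?ys = k"
    using assms by (simp add: card_image)
  have "f a = ?ys ! p a" if "a < k" for a
    using that permute_list_nth[OF p(1), of a] p(2) len by simp
  then show ?thesis
    using p(1) unfolding len by blast
qed

text \<open>A repeated index makes the determinant vanish. Otherwise sorting the rows and the
  columns turns it into a Fock value up to sign.\<close>

lemma zeta_minor_in_span_fock_values:
  assumes m: "\<And>a. a < k \<Longrightarrow> m a > 0" and n: "\<And>b. b < k \<Longrightarrow> n b > 0"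
  shows "detA k (\<lambda>a b. zeta (2 * m a - 1) (2 * n b - 1)) \<in> kdv.span fock_values"
proof (cases "inj_on m {..<k} \<and> inj_on n {..<k}")
  case False
  then consider i j where "i < k" "j < k" "i \<noteq> j" "m i = m j"
    | i j where "i < k" "j < k" "i \<noteq> j" "n i = n j"
    unfolding inj_on_def by blast
  then have "detA k (\<lambda>a b. zeta (2 * m a - 1) (2 * n b - 1)) = 0"
  proof cases
    case (1 i j)
    then show ?thesis by (intro detA_identical_rows[of i k j]) simp_all
  next
    case (2 i j)
    then show ?thesis by (intro detA_identical_cols[of i k j]) simp_all
  qed
  then show ?thesis
    by (simp add: kdv.span_zero)
next
  case True
  let ?f = "\<lambda>a. 2 * m a - 1" and ?g = "\<lambda>b. 2 * n b - 1"
  let ?L = "?f ` {..<k}" and ?J = "?g ` {..<k}"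
  have inj: "inj_on ?f {..<k}" "inj_on ?g {..<k}"
  proof -
    show "inj_on ?f {..<k}"
    proof (rule inj_onI)
      fix a b assume "a \<in> {..<k}" "b \<in> {..<k}" "2 * m a - 1 = 2 * m b - 1"
      moreover from this have "m a = m b"
        using m[of a] m[of b] by simp
      ultimately show "a = b"
        using True by (auto simp: inj_on_def)
    qed
    show "inj_on ?g {..<k}"
    proof (rule inj_onI)
      fix a b assume "a \<in> {..<k}" "b \<in> {..<k}" "2 * n a - 1 = 2 * n b - 1"
      moreover from this have "n a = n b"
        using n[of a] n[of b] by simp
      ultimately show "a = b"
        using True by (auto simp: inj_on_def)
    qed
  qed
  obtain p where p: "p permutes {..<k}" "\<forall>a<k. ?f a = sorted_list_of_set ?L ! p a"
    using sorting_permutation[OF inj(1)] by (elim exE conjE)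
  obtain q where q: "q permutes {..<k}" "\<forall>a<k. ?g a = sorted_list_of_set ?J ! q a"
    using sorting_permutation[OF inj(2)] by (elim exE conjE)
  let ?Z = "\<lambda>a b. zeta (sorted_list_of_set ?L ! a) (sorted_list_of_set ?J ! b)"
  have card: "card ?L = k" "card ?J = k"
    using inj by (simp_all add: card_image)
  have "detA k (\<lambda>a b. zeta (2 * m a - 1) (2 * n b - 1)) = detA k (\<lambda>a b. ?Z (p a) (q b))"
    by (rule detA_cong) (intro arg_cong2[of _ _ _ _ zeta] p(2)[rule_format] q(2)[rule_format])
  also have "\<dots> = of_int (sign p) * (of_int (sign q) * detA k ?Z)"
    unfolding detA_permute_rows[OF p(1), of "\<lambda>a b. ?Z a (q b)"] detA_permute_cols[OF q(1), of ?Z] ..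
  also have "detA k ?Z = of_int (sgn_IIc ?L) * ev2_basis_value ?L ?J"
  proof -
    have "sgn_IIc ?L * sgn_IIc ?L = 1"
      unfolding sgn_IIc_def by (rule minus_one_mult_self)
    then have "(of_int (sgn_IIc ?L) :: kdv_ring) * of_int (sgn_IIc ?L) = 1"
      by (simp only: of_int_mult[symmetric] of_int_1)
    then show ?thesis
      unfolding ev2_basis_value_def card by (simp only: mult.assoc[symmetric] mult_1)
  qed
  also have "of_int (sign p) * (of_int (sign q) * (of_int (sgn_IIc ?L) * ev2_basis_value ?L ?J)) \<in>
      kdv.span fock_values"
  proof -
    have odd: "odd (2 * m a - 1)" "odd (2 * n a - 1)" if "a < k" for a
      using m[OF that] n[OF that] by simp_all
    have "fock_label ?L ?J"
      unfolding fock_label_def card using odd by blast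
    then have "ev2_basis_value ?L ?J \<in> fock_values"
      unfolding fock_values_def by blast
    then have v: "ev2_basis_value ?L ?J \<in> kdv.span fock_values"
      by (rule kdv.span_base)
    have "of_int c * x \<in> kdv.span fock_values" if "x \<in> kdv.span fock_values" for c x
      using kdv.span_scale[OF that, of "of_int c"] by (simp only: cst_of_int)
    from this[OF this[OF this[OF v]]] show ?thesis .
  qed
  finally show ?thesis .
qed

text \<open>Such monomials are combinations of minors of \<open>omega\<close>, and each of these is
  a multiple of a minor of \<open>zeta\<close> modulo flow images.\<close>

lemma S_monomials_in_span: "range S_monomial \<subseteq> kdv.span (fock_values \<union> flow_images)"
proof -
  have "omega_minors \<subseteq> kdv.span (fock_values \<union> flow_images)"
  proof
    fix x assume "x \<in> omega_minors"
    then obtain k n m where x: "x = omega_minor k n m" and m: "\<And>a. a < k \<Longrightarrow> m a > 0"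
      and n: "\<And>b. b < k \<Longrightarrow> n b > 0"
      unfolding omega_minors_def by blast
    \<comment> \<open>A product of positive odd integers, hence invertible in the complex
      numbers.\<close>
    define c :: nat where "c = (\<Prod>b<k. 2 * n b - 1)"
    have "c > 0"
      unfolding c_def
    proof (rule prod_pos)
      fix b assume "b \<in> {..<k}"
      with n[of b] show "0 < 2 * n b - 1" by simp
    qed
    then have "c \<noteq> 0" by simp
    let ?Z = "detA k (\<lambda>a b. zeta (2 * m a - 1) (2 * n b - 1))"
    have "cst (1 / of_nat c) * cst (of_nat c) = 1"
      using \<open>c \<noteq> 0\<close> by (simp add: cst_mult[symmetric])
    then have x_eq: "x = cst (1 / of_nat c) * (?Z - (?Z - (\<Prod>b<k. of_nat (2 * n b - 1)) * omega_minor k n m))"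
      unfolding x of_nat_prod[symmetric] c_def[symmetric] cst_of_nat
      by (simp add: mult.assoc[symmetric])
    have a: "?Z - (\<Prod>b<k. of_nat (2 * n b - 1)) * omega_minor k n m \<in>
        kdv.span (fock_values \<union> flow_images)"
      using zeta_minor_minus_omega_minor[of k m n, OF m n] by (rule subsetD[OF kdv.span_mono[OF Un_upper2]])
    have b: "?Z \<in> kdv.span (fock_values \<union> flow_images)"
      using zeta_minor_in_span_fock_values[of k m n, OF m n] by (rule subsetD[OF kdv.span_mono[OF Un_upper1]])
    show "x \<in> kdv.span (fock_values \<union> flow_images)"
      unfolding x_eq by (rule kdv.span_scale[OF kdv.span_diff[OF b a]])
  qed
  then have "kdv.span omega_minors \<subseteq> kdv.span (fock_values \<union> flow_images)"
    by (rule kdv.span_minimal) (rule kdv.subspace_span)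
  then show ?thesis
    using S_monomial_in_span_omega_minors by blast
qed

lemma span_S_monomials_eq_span_fock_values:
  "kdv.span (range S_monomial \<union> flow_images) = kdv.span (fock_values \<union> flow_images)"
  unfolding kdv.span_eq
  by (intro conjI Un_least S_monomials_in_span fock_value_in_span order.trans[OF _ kdv.span_superset] Un_upper2)

section \<open>The weight grading\<close>

definition weight :: "(nat \<Rightarrow>\<^sub>0 nat) \<Rightarrow> nat" where
  "weight m = (\<Sum>k\<in>keys m. (k + 2) * lookup m k)"

definition homogeneous :: "nat \<Rightarrow> kdv_ring \<Rightarrow> bool" where
  "homogeneous w p \<longleftrightarrow> (\<forall>m. lookup p m \<noteq> 0 \<longrightarrow> weight m = w)"

definition weight_part :: "nat \<Rightarrow> kdv_ring \<Rightarrow> kdv_ring" where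
  "weight_part w p = Poly_Mapping.mapp (\<lambda>m c. c when weight m = w) p"

lemma lookup_weight_part: "lookup (weight_part w p) m = (lookup p m when weight m = w)"
  by (simp add: weight_part_def lookup_mapp when_def in_keys_iff)

lemma weight_superset:
  assumes "finite I" "keys m \<subseteq> I"
  shows "weight m = (\<Sum>k\<in>I. (k + 2) * lookup m k)"
  unfolding weight_def using assms by (intro sum.mono_neutral_left) (auto simp: in_keys_iff)

lemma weight_add: "weight (m + n) = weight m + weight n"
proof -
  let ?I = "keys m \<union> keys n"
  have "weight (m + n) = (\<Sum>k\<in>?I. (k + 2) * lookup (m + n) k)"
    by (rule weight_superset) (auto simp: Poly_Mapping.keys_add)
  then show ?thesis
    by (simp only: weight_superset[of ?I] lookup_add distrib_left sum.distrib finite_Un finite_keys Un_upper1 Un_upper2 simp_thms)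
qed

lemma weight_single [simp]: "weight (single k e) = (k + 2) * e"
  by (cases "e = 0") (simp_all add: weight_def)

lemma homogeneous_weight_part: "homogeneous w (weight_part w p)"
  by (simp add: homogeneous_def lookup_weight_part)

lemma weight_part_homogeneous:
  assumes "homogeneous v p"
  shows "weight_part w p = (if v = w then p else 0)"
  using assms by (intro poly_mapping_eqI) (auto simp: lookup_weight_part homogeneous_def when_def)

lemma weight_part_add: "weight_part w (p + q) = weight_part w p + weight_part w q"
  by (intro poly_mapping_eqI) (simp add: lookup_weight_part lookup_add when_def)

lemma weight_part_scale: "weight_part w (cst c * p) = cst c * weight_part w p"
  by (intro poly_mapping_eqI) (simp add: lookup_weight_part when_def)

lemma weight_part_0: "weight_part w 0 = 0"
  by (intro poly_mapping_eqI) (simp add: lookup_weight_part)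

lemma weight_part_sum: "weight_part w (\<Sum>i\<in>I. f i) = (\<Sum>i\<in>I. weight_part w (f i))"
  by (induction I rule: infinite_finite_induct) (simp_all add: weight_part_add weight_part_0)

lemma sum_weight_parts:
  assumes "finite W" "\<And>m. lookup p m \<noteq> 0 \<Longrightarrow> weight m \<in> W"
  shows "(\<Sum>w\<in>W. weight_part w p) = p"
proof (rule poly_mapping_eqI)
  fix m
  have "lookup (\<Sum>w\<in>W. weight_part w p) m = (\<Sum>w\<in>W. if weight m = w then lookup p m else 0)"
    by (simp add: lookup_sum lookup_weight_part when_def)
  also have "\<dots> = lookup p m"
    using assms by (simp add: sum.delta') metis
  finally show "lookup (\<Sum>w\<in>W. weight_part w p) m = lookup p m" .
qed

lemma homogeneous_0 [simp]: "homogeneous w 0"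
  by (simp add: homogeneous_def)

lemma homogeneous_cst [simp]: "homogeneous 0 (cst c)"
  by (auto simp: homogeneous_def cst_def lookup_single when_def weight_def)

lemma homogeneous_1 [simp]: "homogeneous 0 1"
  using homogeneous_cst[of 1] by simp

lemma homogeneous_uvar: "homogeneous (k + 2) (uvar k)"
  by (auto simp: homogeneous_def uvar_def lookup_single when_def)

lemma homogeneous_add: "homogeneous w p \<Longrightarrow> homogeneous w q \<Longrightarrow> homogeneous w (p + q)"
  unfolding homogeneous_def lookup_add by (metis add_0)

lemma homogeneous_diff: "homogeneous w p \<Longrightarrow> homogeneous w q \<Longrightarrow> homogeneous w (p - q)"
  unfolding homogeneous_def lookup_minus by (metis diff_0_right)

lemma homogeneous_sum: "(\<And>i. i \<in> I \<Longrightarrow> homogeneous w (f i)) \<Longrightarrow> homogeneous w (\<Sum>i\<in>I. f i)"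
  by (induction I rule: infinite_finite_induct) (simp_all add: homogeneous_add)

lemma homogeneous_scale: "homogeneous w p \<Longrightarrow> homogeneous w (cst c * p)"
  by (simp add: homogeneous_def)

lemma homogeneous_mult:
  assumes "homogeneous v p" "homogeneous w q"
  shows "homogeneous (v + w) (p * q)"
  unfolding homogeneous_def
proof (intro allI impI)
  fix m assume "lookup (p * q) m \<noteq> 0"
  then have "m \<in> keys (p * q)"
    by (simp add: in_keys_iff)
  then obtain a b where "a \<in> keys p" "b \<in> keys q" "m = a + b"
    using keys_mult[of p q] by blast
  then show "weight m = v + w"
    using assms by (simp add: weight_add homogeneous_def in_keys_iff)
qed

lemma homogeneous_of_int_mult: "homogeneous w p \<Longrightarrow> homogeneous w (of_int c * p)"
  using homogeneous_scale[of w p "of_int c"] by (simp add: cst_of_int)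

lemma homogeneous_numeral_mult: "homogeneous w p \<Longrightarrow> homogeneous w (numeral c * p)"
  using homogeneous_scale[of w p "numeral c"] by (simp add: cst_numeral)

lemma homogeneous_prod:
  "finite I \<Longrightarrow> (\<And>i. i \<in> I \<Longrightarrow> homogeneous (w i) (f i)) \<Longrightarrow> homogeneous (\<Sum>i\<in>I. w i) (\<Prod>i\<in>I. f i)"
  by (induction I rule: finite_induct) (simp_all add: homogeneous_mult)

lemma homogeneous_power: "homogeneous w p \<Longrightarrow> homogeneous (n * w) (p ^ n)"
  by (induction n) (simp_all add: homogeneous_mult)

lemma homogeneous_derivation_ext:
  assumes "\<And>k. homogeneous (k + 2 + e) (f k)" "homogeneous w p"
  shows "homogeneous (w + e) (derivation_ext f p)"
  unfolding derivation_ext_def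
proof (intro homogeneous_sum)
  fix m k assume m: "m \<in> keys p" and k: "k \<in> keys m"
  have "m - single k 1 + single k 1 = m"
    using k by (intro poly_mapping_eqI) (auto simp: lookup_add lookup_minus lookup_single when_def in_keys_iff)
  then have "weight (m - single k 1) + (k + 2) = w"
    using weight_add[of "m - single k 1" "single k 1"] assms(2) m by (simp add: homogeneous_def in_keys_iff)
  then have w: "w + e = 0 + weight (m - single k 1) + (k + 2 + e)"
    by simp
  have "homogeneous (weight (m - single k 1)) (single (m - single k 1) 1)"
    by (auto simp: homogeneous_def lookup_single when_def)
  then show "homogeneous (w + e) (cst (lookup p m * of_nat (lookup m k)) * single (m - single k 1) 1 * f k)"
    unfolding w by (intro homogeneous_mult assms homogeneous_cst)
qed

lemma weight_part_derivation_ext: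
  assumes "\<And>k. homogeneous (k + 2 + e) (f k)"
  shows "weight_part w (derivation_ext f p) =
    (if e \<le> w then derivation_ext f (weight_part (w - e) p) else 0)"
proof -
  \<comment> \<open>\<open>w - e\<close> is inserted so that the sum over \<open>W\<close> contains
    the relevant index even if \<open>p\<close> has no term of that weight.\<close>
  define W where "W = insert (w - e) (weight ` keys p)"
  have "(\<Sum>v\<in>W. weight_part v p) = p"
    by (rule sum_weight_parts) (auto simp: W_def in_keys_iff)
  then have "weight_part w (derivation_ext f p) = weight_part w (derivation_ext f (\<Sum>v\<in>W. weight_part v p))"
    by simp
  also have "\<dots> = (\<Sum>v\<in>W. weight_part w (derivation_ext f (weight_part v p)))"
    by (simp add: derivation_ext_sum weight_part_sum)
  also have "\<dots> = (\<Sum>v\<in>W. if v + e = w then derivation_ext f (weight_part v p) else 0)"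
    by (intro sum.cong refl weight_part_homogeneous homogeneous_derivation_ext assms homogeneous_weight_part)
  also have "\<dots> = (if e \<le> w then derivation_ext f (weight_part (w - e) p) else 0)"
  proof (cases "e \<le> w")
    case True
    then have "v + e = w \<longleftrightarrow> v = w - e" for v
      by auto
    then show ?thesis
      using True by (simp add: W_def)
  next
    case False
    then have "v + e \<noteq> w" for v
      by auto
    then show ?thesis
      using False by simp
  qed
  finally show ?thesis .
qed

section \<open>Weights of the coefficients, the flows and their determinants\<close>

lemma homogeneous_dprime: "homogeneous w p \<Longrightarrow> homogeneous (w + 1) (dprime p)"
  unfolding dprime_def using homogeneous_uvar[of "Suc _"]
  by (intro homogeneous_derivation_ext) simp_all

text \<open>Two applications of \<open>dprime\<close> and a factor \<open>uvar 0\<close> each add 2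
  to the weight, while the last sum of the recursion already has the full weight.\<close>

lemma homogeneous_resolvent_coeff: "homogeneous (2 * n) (sq n)"
proof (induction n rule: less_induct)
  case (less n)
  show ?case
  proof (cases n)
    case (Suc m)
    have IH: "homogeneous (2 * i) (sq i)" if "i \<le> m" for i
      using less[of i] that Suc by simp
    have mult: "homogeneous w (p * q)" if "homogeneous v p" "homogeneous v' q" "v + v' = w" for v v' w p q
      using homogeneous_mult[OF that(1,2)] that(3) by simp
    have "homogeneous (2 * i + 1 + 1) (dprime (dprime (sq i)))" "homogeneous (2 * i + 1) (dprime (sq i))"
      if "i \<le> m" for i
      using that by (intro homogeneous_dprime IH; simp)+
    note D = this
    have "homogeneous (2 * n) (2 * (sq i * dprime (dprime (sq (m - i))))
          - dprime (sq i) * dprime (sq (m - i))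
          - 4 * (uvar 0 * (sq i * sq (m - i))))" if "i \<le> m" for i
    proof (intro homogeneous_diff homogeneous_numeral_mult)
      have i: "m - i \<le> m" by simp
      show "homogeneous (2 * n) (sq i * dprime (dprime (sq (m - i))))"
        by (rule mult[OF IH[OF that] D(1)[OF i]]) (use that Suc in simp)
      show "homogeneous (2 * n) (dprime (sq i) * dprime (sq (m - i)))"
        by (rule mult[OF D(2)[OF that] D(2)[OF i]]) (use that Suc in simp)
      show "homogeneous (2 * n) (uvar 0 * (sq i * sq (m - i)))"
        by (rule mult[OF homogeneous_uvar mult[OF IH[OF that] IH[OF i] refl]]) (use that Suc in simp)
    qed
    moreover have "homogeneous (2 * n) (4 * (\<Sum>i\<in>{1..m}. sq i * sq (Suc m - i)))"
      using Suc by (intro homogeneous_numeral_mult homogeneous_sum mult[OF IH IH]) auto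
    ultimately have "homogeneous (2 * n) ((\<Sum>i\<le>m. 2 * (sq i * dprime (dprime (sq (m - i))))
          - dprime (sq i) * dprime (sq (m - i)) - 4 * (uvar 0 * (sq i * sq (m - i))))
          - 4 * (\<Sum>i\<in>{1..m}. sq i * sq (Suc m - i)))"
      by (intro homogeneous_diff[OF homogeneous_sum]) simp_all
    from homogeneous_scale[OF this] show ?thesis
      by (simp only: Suc resolvent_coeff.simps(2) mult.assoc)
  qed simp
qed

lemma homogeneous_flow_generator: "homogeneous (k + 2 + (2 * i + 1)) ((dprime ^^ Suc k) (sq (Suc i)))"
proof -
  have "homogeneous (2 * Suc i + j) ((dprime ^^ j) (sq (Suc i)))" for j
  proof (induction j)
    case 0
    then show ?case
      using homogeneous_resolvent_coeff[of "Suc i"] by simp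
  next
    case (Suc j)
    then show ?case
      using homogeneous_dprime[OF Suc] by simp
  qed
  from this[of "Suc k"] show ?thesis
    by (simp add: algebra_simps del: funpow.simps)
qed

lemma homogeneous_flow: "homogeneous w p \<Longrightarrow> homogeneous (w + (2 * i + 1)) (flow (Suc i) p)"
  unfolding flow_def by (rule homogeneous_derivation_ext[OF homogeneous_flow_generator])

lemma weight_part_flow: "weight_part w (flow (Suc i) p) =
    (if 2 * i + 1 \<le> w then flow (Suc i) (weight_part (w - (2 * i + 1)) p) else 0)"
  unfolding flow_def by (rule weight_part_derivation_ext[OF homogeneous_flow_generator])

text \<open>Any part of another weight is killed by \<partial>_1, which raises the weight by 1, and
  has zero constant term, so it vanishes.\<close>

lemma homogeneous_zeta:
  assumes "n > 0"
  shows "homogeneous (2 * i + 2 * n) (zeta (2 * i + 1) (2 * n - 1))"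
proof -
  let ?z = "zeta (2 * i + 1) (2 * n - 1)"
  have z: "flow 1 ?z = flow (Suc i) (sq n)" "const_term ?z = 0"
    using flow_1_zeta[of n "Suc i"] const_term_zeta[of n "Suc i"] assms by simp_all
  have "weight_part v ?z = 0" if "v \<noteq> 2 * i + 2 * n" for v
  proof (rule flow_1_inj)
    have "weight_part (v + 1) (flow 1 ?z) = flow 1 (weight_part v ?z)"
      using weight_part_flow[of "v + 1" 0 ?z] by simp
    moreover have "homogeneous (2 * i + 2 * n + 1) (flow 1 ?z)"
      unfolding z(1) using homogeneous_flow[OF homogeneous_resolvent_coeff, of n i] by (simp add: algebra_simps)
    ultimately show "flow 1 (weight_part v ?z) = flow 1 0"
      using weight_part_homogeneous[of "2 * i + 2 * n + 1" "flow 1 ?z" "v + 1"] that by simp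
    show "const_term (weight_part v ?z) = const_term 0"
      using z(2) by (simp add: const_term_def lookup_weight_part when_def)
  qed
  then have "lookup ?z m = 0" if "weight m \<noteq> 2 * i + 2 * n" for m
    using that lookup_weight_part[of "weight m" ?z m] by simp
  then show ?thesis
    unfolding homogeneous_def by blast
qed

text \<open>The weight of an entry splits into a row part and a column part, so the products for all
  permutations have the same weight.\<close>

lemma homogeneous_detA:
  assumes "\<And>a b. a < k \<Longrightarrow> b < k \<Longrightarrow> homogeneous (f a + g b) (M a b)"
  shows "homogeneous ((\<Sum>a<k. f a) + (\<Sum>b<k. g b)) (detA k M)"
  unfolding detA_def
proof (intro homogeneous_sum homogeneous_of_int_mult)
  fix p assume "p \<in> perms k"
  then have p: "p permutes {..<k}" by simp
  have "homogeneous (\<Sum>a<k. f a + g (p a)) (\<Prod>a<k. M a (p a))"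
    by (intro homogeneous_prod assms) (use permutes_in_image[OF p] in auto)
  moreover have "(\<Sum>a<k. g (p a)) = (\<Sum>b<k. g b)"
    using sum.permute[OF p, of g] by (simp add: comp_def)
  ultimately show "homogeneous ((\<Sum>a<k. f a) + (\<Sum>b<k. g b)) (\<Prod>a<k. M a (p a))"
    by (simp add: sum.distrib)
qed

lemma fock_value_homogeneous:
  assumes "fock_label L J"
  shows "\<exists>w. homogeneous w (ev2_basis_value L J)"
proof -
  let ?l = "\<lambda>a. sorted_list_of_set L ! a" and ?j = "\<lambda>b. sorted_list_of_set J ! b"
  have k: "card L = card J" and fin: "finite L" "finite J"
    using assms by (auto simp: fock_label_def)
  have mem: "?l a \<in> L" "?j a \<in> J" if "a < card L" for a
    using that k fin nth_mem[of a "sorted_list_of_set L"] nth_mem[of a "sorted_list_of_set J"] by simp_all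
  have "homogeneous (?l a + ?j b) (zeta (?l a) (?j b))" if "a < card L" "b < card L" for a b
  proof -
    have "odd (?l a)" "odd (?j b)"
      using mem(1)[OF that(1)] mem(2)[OF that(2)] assms unfolding fock_label_def by blast+
    then obtain i n where in': "?l a = 2 * i + 1" "?j b = 2 * n + 1"
      by (elim oddE)
    show ?thesis
      using homogeneous_zeta[of "Suc n" i] unfolding in' by (simp add: algebra_simps)
  qed
  then have "homogeneous ((\<Sum>a<card L. ?l a) + (\<Sum>b<card L. ?j b)) (detA (card L) (\<lambda>a b. zeta (?l a) (?j b)))"
    by (rule homogeneous_detA)
  then show ?thesis
    unfolding ev2_basis_value_def by (intro exI homogeneous_of_int_mult)
qed

lemma S_monomial_homogeneous: "\<exists>w. homogeneous w (S_monomial s)"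
proof
  show "homogeneous (\<Sum>i\<in>keys s. lookup s i * (2 * Suc i)) (S_monomial s)"
    unfolding S_monomial_eq
    by (intro homogeneous_prod homogeneous_power homogeneous_resolvent_coeff) simp
qed

section \<open>Generators of the differential polynomial ring over the flows\<close>

lemma flow_funpow_commute: "flow i ((flow j ^^ n) p) = (flow j ^^ n) (flow i p)"
  by (induction n) (simp_all add: flow_commute[of i j])

text \<open>\<open>D_monomial_act\<close> with the list of indices as a parameter, so that indices
  with exponent zero can be included.\<close>

definition flow_word :: "nat list \<Rightarrow> (nat \<Rightarrow>\<^sub>0 nat) \<Rightarrow> kdv_ring \<Rightarrow> kdv_ring" where
  "flow_word xs d = foldr (\<lambda>i g. (flow (Suc i) ^^ lookup d i) \<circ> g) xs id"

lemma flow_word_Nil [simp]: "flow_word [] d = id"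
  and flow_word_Cons [simp]: "flow_word (i # xs) d = (flow (Suc i) ^^ lookup d i) \<circ> flow_word xs d"
  by (simp_all add: flow_word_def)

lemma D_monomial_act_eq: "D_monomial_act d = flow_word (sorted_list_of_set (keys d)) d"
  unfolding D_monomial_act_def flow_word_def kdv_flow_eq ..

lemma flow_word_cong:
  "(\<And>i. i \<in> set xs \<Longrightarrow> lookup d i = lookup e i) \<Longrightarrow> flow_word xs d = flow_word xs e"
  by (induction xs) simp_all

lemma flow_word_insort:
  "lookup d i = 0 \<Longrightarrow> flow_word (insort i xs) d = flow_word xs d"
  by (induction xs) simp_all

lemma flow_word_add_single:
  "distinct xs \<Longrightarrow> i \<in> set xs \<Longrightarrow>
    flow_word xs (d + single i 1) p = flow (Suc i) (flow_word xs d p)"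
proof (induction xs)
  case (Cons x xs)
  show ?case
  proof (cases "x = i")
    case True
    then have "flow_word xs (d + single i 1) = flow_word xs d"
      using Cons.prems by (intro flow_word_cong) (auto simp: lookup_add lookup_single when_def)
    then show ?thesis
      using True by (simp add: lookup_add)
  next
    case False
    then have "lookup (d + single i 1) x = lookup d x"
      by (simp add: lookup_add lookup_single)
    then show ?thesis
      using Cons False by (simp add: flow_funpow_commute)
  qed
qed simp

lemma flow_D_monomial_act:
  "flow (Suc i) (D_monomial_act d p) = D_monomial_act (d + single i 1) p"
proof -
  have keys: "keys (d + single i 1) = insert i (keys d)"
    by (auto simp: in_keys_iff lookup_add lookup_single when_def split: if_splits)
  let ?xs = "sorted_list_of_set (insert i (keys d))"
  \<comment> \<open>The index i may be absent from \<open>d\<close>; then it enters the list with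
    exponent zero, which changes nothing.\<close>
  have "flow_word ?xs d = flow_word (sorted_list_of_set (keys d)) d"
  proof (cases "i \<in> keys d")
    case False
    then have "?xs = insort i (sorted_list_of_set (keys d))"
      by (simp add: sorted_list_of_set_insert)
    then show ?thesis
      using False flow_word_insort[of d i] by (simp only: in_keys_iff not_not)
  qed (simp add: insert_absorb)
  moreover have "flow_word ?xs (d + single i 1) p = flow (Suc i) (flow_word ?xs d p)"
    by (rule flow_word_add_single) (simp_all only: distinct_sorted_list_of_set set_sorted_list_of_set finite_insert finite_keys insertI1)
  ultimately show ?thesis
    unfolding D_monomial_act_eq keys by simp
qed

lemma D_monomial_act_0 [simp]: "D_monomial_act 0 p = p"
  by (simp add: D_monomial_act_def)

lemma D_monomial_act_in_flow_images:
  assumes "d \<noteq> 0"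
  shows "D_monomial_act d p \<in> flow_images"
proof -
  obtain i xs where xs: "sorted_list_of_set (keys d) = i # xs"
    using assms by (cases "sorted_list_of_set (keys d)") auto
  then have "i \<in> keys d"
    by (metis finite_keys list.set_intros(1) set_sorted_list_of_set)
  then obtain e where e: "lookup d i = Suc e"
    using not0_implies_Suc by (auto simp: in_keys_iff)
  have "D_monomial_act d p = flow (Suc i) ((flow (Suc i) ^^ e) (flow_word xs d p))"
    unfolding D_monomial_act_eq xs by (simp add: e)
  then show ?thesis
    unfolding flow_images_def by blast
qed

text \<open>A graded Nakayama lemma, by induction on the weight.\<close>
lemma span_D_monomial_act_eq_UNIV_iff:
  assumes "\<And>b. b \<in> B \<Longrightarrow> \<exists>w. homogeneous w b"
  shows "kdv.span ((\<lambda>(d, b). D_monomial_act d b) ` (UNIV \<times> B)) = UNIV \<longleftrightarrow>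
    kdv.span (B \<union> flow_images) = UNIV"
proof
  let ?G = "(\<lambda>(d, b). D_monomial_act d b) ` (UNIV \<times> B)"
  assume "kdv.span ?G = UNIV"
  moreover have "?G \<subseteq> B \<union> flow_images"
  proof
    fix x assume "x \<in> ?G"
    then obtain d b where "x = D_monomial_act d b" "b \<in> B"
      by auto
    then show "x \<in> B \<union> flow_images"
      by (cases "d = 0") (simp_all add: D_monomial_act_in_flow_images)
  qed
  then have "kdv.span ?G \<subseteq> kdv.span (B \<union> flow_images)"
    by (rule kdv.span_mono)
  ultimately show "kdv.span (B \<union> flow_images) = UNIV"
    by (simp only: top.extremum_unique)
next
  let ?G = "(\<lambda>(d, b). D_monomial_act d b) ` (UNIV \<times> B)"
  assume UNIV: "kdv.span (B \<union> flow_images) = UNIV"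
  have B: "b \<in> kdv.span ?G" if "b \<in> B" for b
    by (rule kdv.span_base) (use that in \<open>auto intro!: image_eqI[of _ _ "(0, b)"]\<close>)
  \<comment> \<open>The span is a submodule over the ring of flows.\<close>
  have flow: "flow (Suc i) x \<in> kdv.span ?G" if "x \<in> kdv.span ?G" for i x
    using that
  proof (induction rule: kdv.span_induct_alt)
    case base
    then show ?case
      by (simp add: kdv.span_zero)
  next
    case (step c x y)
    then obtain d b where x: "x = D_monomial_act d b" "b \<in> B"
      by auto
    have "flow (Suc i) x \<in> kdv.span ?G"
      unfolding x(1) flow_D_monomial_act
      by (rule kdv.span_base) (use x(2) in \<open>auto intro!: image_eqI[of _ _ "(d + single i 1, b)"]\<close>)
    then show ?case
      unfolding flow.add flow_scale using step by (intro kdv.span_add kdv.span_scale)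
  qed
  \<comment> \<open>The part of weight w of a flow image is zero or the flow of a part of strictly
    smaller weight, to which the induction hypothesis and \<open>flow\<close> apply. An element of
    \<open>B\<close> is homogeneous, so its part is itself or zero.\<close>
  have part: "weight_part w x \<in> kdv.span ?G" for w x
  proof (induction w arbitrary: x rule: less_induct)
    case (less w)
    have "x \<in> kdv.span (B \<union> flow_images)"
      by (simp only: UNIV UNIV_I)
    then show ?case
    proof (induction rule: kdv.span_induct_alt)
      case base
      then show ?case
        by (simp add: weight_part_0 kdv.span_zero)
    next
      case (step c y z)
      have "weight_part w y \<in> kdv.span ?G"
      proof (cases "y \<in> B")
        case True
        from assms[OF this] obtain v where "homogeneous v y" ..
        then show ?thesis
          using B[OF True] by (simp add: weight_part_homogeneous kdv.span_zero)
      next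
        case False
        then obtain i p where y: "y = flow (Suc i) p"
          using step unfolding flow_images_def by blast
        show ?thesis
          unfolding y weight_part_flow using less by (auto intro!: flow simp: kdv.span_zero)
      qed
      then show ?case
        unfolding weight_part_add weight_part_scale using step by (intro kdv.span_add kdv.span_scale)
    qed
  qed
  have "x \<in> kdv.span ?G" for x
  proof -
    have "(\<Sum>w\<in>weight ` keys x. weight_part w x) = x"
      by (rule sum_weight_parts) (auto simp: in_keys_iff)
    moreover have "(\<Sum>w\<in>weight ` keys x. weight_part w x) \<in> kdv.span ?G"
      by (intro kdv.span_sum part)
    ultimately show ?thesis
      by simp
  qed
  then show "kdv.span ?G = UNIV"
    by blast
qed

section \<open>Both surjectivity statements as spanning statements modulo flow images\<close>

lemma ev1_surjective_iff: "ev1_surjective \<longleftrightarrow> kdv.span (range S_monomial \<union> flow_images) = UNIV"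
proof -
  let ?h = "\<lambda>(d, s). D_monomial_act d (S_monomial s)"
  have "ev1 = lin_ext ?h"
    by (auto simp: fun_eq_iff ev1_def lin_ext_def intro!: sum.cong)
  then have "ev1_surjective \<longleftrightarrow> {lin_ext ?h T |T. keys T \<subseteq> UNIV} = UNIV"
    unfolding ev1_surjective_def by (simp add: full_SetCompr_eq)
  also have "\<dots> \<longleftrightarrow> kdv.span (range ?h) = UNIV"
    unfolding lin_ext_image_eq_span ..
  also have "range ?h = (\<lambda>(d, b). D_monomial_act d b) ` (UNIV \<times> range S_monomial)"
    by (auto simp: image_iff)
  also have "kdv.span \<dots> = UNIV \<longleftrightarrow> kdv.span (range S_monomial \<union> flow_images) = UNIV"
    by (rule span_D_monomial_act_eq_UNIV_iff) (use S_monomial_homogeneous in blast)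
  finally show ?thesis .
qed

lemma ev2_surjective_iff: "ev2_surjective \<longleftrightarrow> kdv.span (fock_values \<union> flow_images) = UNIV"
proof -
  let ?h = "\<lambda>(d, L, J). D_monomial_act d (ev2_basis_value L J)"
  let ?I = "{(d :: nat \<Rightarrow>\<^sub>0 nat, L, J). fock_label L J}"
  have ev2: "ev2 = lin_ext ?h"
    by (auto simp: fun_eq_iff ev2_def lin_ext_def intro!: sum.cong)
  have "(\<forall>(d, L, J)\<in>keys T. fock_label L J) \<longleftrightarrow> keys T \<subseteq> ?I"
    for T :: "((nat \<Rightarrow>\<^sub>0 nat) \<times> (nat set \<times> nat set)) \<Rightarrow>\<^sub>0 complex"
    by auto
  then have "ev2_surjective \<longleftrightarrow> {lin_ext ?h T |T. keys T \<subseteq> ?I} = UNIV"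
    unfolding ev2_surjective_def ev2 set_eq_iff mem_Collect_eq by (simp only: UNIV_I simp_thms) metis
  also have "\<dots> \<longleftrightarrow> kdv.span (?h ` ?I) = UNIV"
    unfolding lin_ext_image_eq_span ..
  also have "?h ` ?I = (\<lambda>(d, b). D_monomial_act d b) ` (UNIV \<times> fock_values)"
    by (force simp: fock_values_def image_iff)
  also have "kdv.span \<dots> = UNIV \<longleftrightarrow> kdv.span (fock_values \<union> flow_images) = UNIV"
    by (rule span_D_monomial_act_eq_UNIV_iff) (use fock_value_homogeneous in \<open>auto simp: fock_values_def\<close>)
  finally show ?thesis .
qed

theorem theorem3:
  shows "ev1_surjective \<longleftrightarrow> ev2_surjective"
  unfolding ev1_surjective_iff ev2_surjective_iff span_S_monomials_eq_span_fock_values ..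

end
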